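(* In the setting of the equation $X_t=x_0+\theta\int_0^t a(s,X_s)ds+\int_0^t b(s,X_s)dB^H_s$ with $H\in(\frac12,1)$ under hypotheses $(A_1)$, $(A_3)$, $(A_2')$, $(A_4')$, $(B_1)$, $(B_2)$, assume that $\varphi(t)=a(t,X_t)/b(t,X_t)$ is a non-random function satisfying $(B_5)$: there exists $p>0$ such that $\limsup_{T\to\infty}\frac{T^{2H-1+p}}{\int_0^T\varphi^2(t)dt}<\infty$. Then $\theta^{(2)}_T=\theta+\frac{\int_0^T\varphi(s)dB^H_s}{\int_0^T\varphi^2(s)ds}$ is strongly consistent, i.e. $\theta^{(2)}_T\to\theta$ a.s. as $T\to\infty$.
   Context: $B^H$ is a fractional Brownian motion with Hurst index $H$; for non-random $\varphi$, $\int_0^T\varphi\,dB^H$ is the Wiener integral w.r.t. fBm. $\theta^{(2)}_T=\int_0^T\varphi_sdY_s/\int_0^T\varphi_s^2ds$ with $Y_t=\int_0^tb^{-1}(s,X_s)dX_s=\theta\int_0^t\varphi_sds+B^H_t$. Hypotheses (constants may depend on $T$): $(A_1)$ $|a(s,x)|+|b(s,x)|\le K(1+|x|)$; $(A_2')$ $|a(t,x)-a(t,y)|+|b(t,x)-b(t,y)|\le K|x-y|$; $(A_3)$ $b$ differentiable in $x$ and for some $\beta\in(1-H,1)$, $|a(s,x)-a(t,x)|+|b(s,x)-b(t,x)|+|\partial_xb(s,x)-\partial_xb(t,x)|\le K|s-t|^\beta$; $(A_4')$ for some $\rho\in(\frac32-H,1)$, $|\partial_xb(t,x)-\partial_xb(t,y)|\le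 D|x-y|^\rho$. $(B_1)$ $b(t,X_t)\neq0$ and $\varphi$ is integrable on each $[0,T]$. $(B_2)$ with $c_H=\big(\frac{\Gamma(3-2H)}{2H\Gamma(\frac32-H)^3\Gamma(H+\frac12)}\big)^{1/2}$, $J_t=c_H\int_0^t(t-s)^{\frac12-H}s^{\frac12-H}\varphi(s)ds$ is differentiable, and $\chi(t)=(2-2H)^{-1}J'(t)t^{2H-1}$ satisfies $\int_0^T\chi_s^2(2-2H)s^{1-2H}ds<\infty$ for all $T$. *)

theory Defs
  imports "HOL-Probability.Probability"
begin

definition fbm_cov :: "real \<Rightarrow> real \<Rightarrow> real \<Rightarrow> real" where
  "fbm_cov H s t = (s powr (2*H) + t powr (2*H) - \<bar>t - s\<bar> powr (2*H)) / 2"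

text \<open>B is a fractional Brownian motion with Hurst index H on the probability space M
  (time set [0,oo)): B_0 = 0, continuous paths, and B is a centred Gaussian process with
  covariance fbm_cov H (every finite linear combination is centred Gaussian with the
  variance prescribed by the covariance, expressed through its characteristic function).\<close>
definition is_fbm :: "'a measure \<Rightarrow> real \<Rightarrow> (real \<Rightarrow> 'a \<Rightarrow> real) \<Rightarrow> bool" where
  "is_fbm M H B \<longleftrightarrow>
     prob_space M \<and>
     (\<forall>t. B t \<in> borel_measurable M) \<and>
     (\<forall>\<omega>\<in>space M. B 0 \<omega> = 0 \<and> continuous_on {0..} (\<lambda>t. B t \<omega>)) \<and>
     (\<forall>(n::nat) (ts::nat \<Rightarrow> real) (cs::nat \<Rightarrow> real). (\<forall>i<n. 0 \<le> ts i) \<longrightarrow>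
        (\<forall>u. char (distr M borel (\<lambda>\<omega>. \<Sum>i<n. cs i * B (ts i) \<omega>)) u =
             complex_of_real (exp (- (\<Sum>i<n. \<Sum>j<n. cs i * cs j * fbm_cov H (ts i) (ts j)) * u\<^sup>2 / 2))))"

definition rs_has_integral ::
  "(real \<Rightarrow> real) \<Rightarrow> (real \<Rightarrow> real) \<Rightarrow> real \<Rightarrow> real \<Rightarrow> real \<Rightarrow> bool" where
  "rs_has_integral f g a b I \<longleftrightarrow>
     (\<forall>\<epsilon>>0. \<exists>\<delta>>0. \<forall>(n::nat) (x::nat \<Rightarrow> real) (\<xi>::nat \<Rightarrow> real).
        x 0 = a \<and> x n = b \<and>
        (\<forall>i<n. x i < x (Suc i) \<and> x (Suc i) - x i < \<delta> \<and> x i \<le> \<xi> i \<and> \<xi> i \<le> x (Suc i)) \<longrightarrow>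
        \<bar>(\<Sum>i<n. f (\<xi> i) * (g (x (Suc i)) - g (x i))) - I\<bar> < \<epsilon>)"

text \<open>I is (a version of) the Wiener integral of the deterministic function phi over [0,T]
  w.r.t. the fBm B (H > 1/2): the L^2(M)-limit of the integrals of step functions f_k
  that converge to phi in the norm of the space |H|, i.e.
  int int |f_k - phi|(s) |f_k - phi|(u) |s-u|^(2H-2) ds du \<rightarrow> 0.\<close>
definition wiener_integral_fbm ::
  "'a measure \<Rightarrow> real \<Rightarrow> (real \<Rightarrow> 'a \<Rightarrow> real) \<Rightarrow> (real \<Rightarrow> real) \<Rightarrow> real \<Rightarrow> ('a \<Rightarrow> real) \<Rightarrow> bool" where
  "wiener_integral_fbm M H B \<phi> T I \<longleftrightarrow>
     I \<in> borel_measurable M \<and>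
     (\<exists>(n::nat \<Rightarrow> nat) (x::nat \<Rightarrow> nat \<Rightarrow> real) (c::nat \<Rightarrow> nat \<Rightarrow> real).
        (\<forall>k. x k 0 = 0 \<and> x k (n k) = T \<and> (\<forall>i<n k. x k i \<le> x k (Suc i))) \<and>
        (let f = (\<lambda>k s. \<Sum>i<n k. c k i * indicator {x k i ..< x k (Suc i)} s) in
          ((\<lambda>k. \<integral>\<^sup>+ s. \<integral>\<^sup>+ u. ennreal (indicator {0..T} s * indicator {0..T} u *
                 \<bar>f k s - \<phi> s\<bar> * \<bar>f k u - \<phi> u\<bar> * \<bar>s - u\<bar> powr (2*H - 2)) \<partial>lborel \<partial>lborel)
             \<longlonglongrightarrow> 0)) \<and>
        ((\<lambda>k. \<integral>\<^sup>+ \<omega>. ennreal (((\<Sum>i<n k. c k i * (B (x k (Suc i)) \<omega> - B (x k i) \<omega>)) - I \<omega>)\<^sup>2) \<partial>M)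
           \<longlonglongrightarrow> 0))"

definition c_H :: "real \<Rightarrow> real" where
  "c_H H = sqrt (Gamma (3 - 2*H) / (2*H * Gamma (3/2 - H) ^ 3 * Gamma (H + 1/2)))"

definition J_fun :: "real \<Rightarrow> (real \<Rightarrow> real) \<Rightarrow> real \<Rightarrow> real" where
  "J_fun H \<phi> t = c_H H * (LINT s:{0..t}|lborel. (t - s) powr (1/2 - H) * s powr (1/2 - H) * \<phi> s)"

definition chi_fun :: "real \<Rightarrow> (real \<Rightarrow> real) \<Rightarrow> real \<Rightarrow> real" where
  "chi_fun H \<phi> t = deriv (J_fun H \<phi>) t * t powr (2*H - 1) / (2 - 2*H)"

end

theory Submission
  imports Defs
begin

text \<open>
  Write \<open>\<alpha> = 2 * H - 1\<close>, \<open>V T = \<integral>\<^sub>0\<^sup>T \<phi>\<^sup>2\<close> and \<open>I T = \<integral>\<^sub>0\<^sup>T \<phi> dB\<close>. The argument uses only second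
  moments. Symmetry and \<open>\<integral>\<^sub>s\<^sup>t \<bar>r - u\<bar> powr (\<alpha> - 1) du \<le> 2 * (t - s) powr \<alpha> / \<alpha>\<close> give
  \<open>E (I t - I s)\<^sup>2 \<le> 16 * H * (t - s) powr \<alpha> * (V t - V s)\<close>. On a block where both \<open>t\<close> and \<open>V t\<close> at
  most double, the time change \<open>(t - a) / a + (V t - V a) / V a\<close> turns this into a bound of order
  \<open>1 + \<alpha> > 1\<close> in the time increment, so dyadic chaining controls \<open>E sup I\<^sup>2\<close> on the block by a
  multiple of \<open>a powr \<alpha> * V a\<close>. Dividing by \<open>(V a)\<^sup>2\<close>, the sum over all blocks
  \<open>2 ^ i \<le> t \<le> 2 ^ (i + 1)\<close>, \<open>2 ^ j \<le> V t \<le> 2 ^ (j + 1)\<close> converges because \<open>V t\<close> grows at least like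
  \<open>t powr (\<alpha> + p)\<close>, and hence \<open>I T / V T\<close> tends to 0 almost surely.
\<close>

section \<open>The Riesz kernel\<close>

text \<open>A Wiener integral is given only as an L^2 limit along some sequence of step functions,
  and the sequences behind \<open>I t\<close> and \<open>I s\<close> need not be related. So no
  exact isometry is used, only an upper bound: the second moment of a step integral is at most
  \<open>H * (2 * H - 1)\<close> times an energy with absolute values inside. In that energy the two
  approximation errors have to be separated from \<phi> on \<open>{s<..t}\<close>. This requires a
  triangle inequality for a double integral with singular kernel, which is why the kernel is written
  as an integral of products of one-sided powers.

  The increment bound mixes \<open>(t - s) powr \<alpha>\<close> with \<open>V t - V s\<close>, and
  V may be flat in places and steep in others, so neither t nor V alone is a usable clock; the sum
  of the two relative increments dominates both factors. Since the resulting order exceeds 1,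
  chaining works already in L^2 and no higher Gaussian moments enter.\<close>

lemma has_real_derivative_signed_powr:
  assumes "x \<noteq> 0"
  shows "((\<lambda>x::real. sgn x * \<bar>x\<bar> powr \<alpha>) has_real_derivative \<alpha> * \<bar>x\<bar> powr (\<alpha> - 1)) (at x)"
proof (cases "x > 0")
  case True
  have "((\<lambda>x::real. x powr \<alpha>) has_real_derivative \<alpha> * \<bar>x\<bar> powr (\<alpha> - 1)) (at x)"
    using True by (auto intro!: derivative_eq_intros)
  then show ?thesis
    by (rule has_field_derivative_transform_within_open[of _ _ _ "{0<..}"]) (use True in auto)
next
  case False
  have "((\<lambda>x::real. - ((- x) powr \<alpha>)) has_real_derivative \<alpha> * \<bar>x\<bar> powr (\<alpha> - 1)) (at x)"
    using False assms by (auto intro!: derivative_eq_intros)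
  then show ?thesis
    by (rule has_field_derivative_transform_within_open[of _ _ _ "{..<0}"]) (use False assms in auto)
qed

lemma has_real_derivative_abs_powr:
  assumes "x \<noteq> 0"
  shows "((\<lambda>x::real. \<bar>x\<bar> powr (\<alpha> + 1)) has_real_derivative (\<alpha> + 1) * (sgn x * \<bar>x\<bar> powr \<alpha>)) (at x)"
proof (cases "x > 0")
  case True
  have "((\<lambda>x::real. x powr (\<alpha> + 1)) has_real_derivative (\<alpha> + 1) * (sgn x * \<bar>x\<bar> powr \<alpha>)) (at x)"
    using True by (auto intro!: derivative_eq_intros)
  then show ?thesis
    by (rule has_field_derivative_transform_within_open[of _ _ _ "{0<..}"]) (use True in auto)
next
  case False
  have "((\<lambda>x::real. (- x) powr (\<alpha> + 1)) has_real_derivative (\<alpha> + 1) * (sgn x * \<bar>x\<bar> powr \<alpha>)) (at x)"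
    using False assms by (auto intro!: derivative_eq_intros)
  then show ?thesis
    by (rule has_field_derivative_transform_within_open[of _ _ _ "{..<0}"]) (use False assms in auto)
qed

lemma continuous_on_signed_powr:
  assumes "0 < \<alpha>"
  shows "continuous_on UNIV (\<lambda>x::real. sgn x * \<bar>x\<bar> powr \<alpha>)"
proof -
  \<comment> \<open>The jump of \<open>sgn\<close> at 0 disappears when the function is split into
    powers of its positive and negative parts.\<close>
  have "(\<lambda>x::real. sgn x * \<bar>x\<bar> powr \<alpha>) = (\<lambda>x. max 0 x powr \<alpha> - max 0 (- x) powr \<alpha>)"
    using assms by (auto simp: fun_eq_iff sgn_if max_def)
  moreover have "continuous_on UNIV (\<lambda>x::real. max 0 x powr \<alpha> - max 0 (- x) powr \<alpha>)"
    using assms by (intro continuous_on_diff continuous_on_powr' continuous_intros) auto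
  ultimately show ?thesis by (simp only:)
qed

text \<open>For \<open>\<alpha> < 1\<close> the kernel is unbounded at \<open>u = s\<close>, but its
  antiderivative, a signed power, stays continuous there. This is what the fundamental theorem with
  an exceptional point asks for.\<close>

lemma nn_integral_riesz_interval:
  fixes a b s \<alpha> :: real
  assumes "0 < \<alpha>" "a \<le> b"
  shows "(\<integral>\<^sup>+u. ennreal (\<bar>s - u\<bar> powr (\<alpha> - 1)) * indicator {a..b} u \<partial>lborel)
    = ennreal ((sgn (b - s) * \<bar>b - s\<bar> powr \<alpha> - sgn (a - s) * \<bar>a - s\<bar> powr \<alpha>) / \<alpha>)"
proof -
  let ?F = "\<lambda>u. (sgn (u - s) * \<bar>u - s\<bar> powr \<alpha>) / \<alpha>"
  have "((\<lambda>u. \<bar>s - u\<bar> powr (\<alpha> - 1)) has_integral ?F b - ?F a) {a..b}"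
  proof (rule fundamental_theorem_of_calculus_interior_strong[of "{s}"])
    fix x assume "x \<in> {a<..<b} - {s}"
    then have "x - s \<noteq> 0" by auto
    have lin: "((\<lambda>x. x - s) has_real_derivative 1) (at x)" by (auto intro!: derivative_eq_intros)
    from \<open>x - s \<noteq> 0\<close> DERIV_chain2[where f = "\<lambda>x. sgn x * \<bar>x\<bar> powr \<alpha>" and g = "\<lambda>x. x - s" and s = UNIV and Db = 1, OF has_real_derivative_signed_powr[OF \<open>x - s \<noteq> 0\<close>] lin]
    have "((\<lambda>x. sgn (x - s) * \<bar>x - s\<bar> powr \<alpha>) has_real_derivative \<alpha> * \<bar>x - s\<bar> powr (\<alpha> - 1)) (at x)"
      by simp
    from DERIV_cdivide[OF this, of \<alpha>]
    have "(?F has_real_derivative \<bar>x - s\<bar> powr (\<alpha> - 1)) (at x)"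
      using assms by simp
    then show "(?F has_vector_derivative \<bar>s - x\<bar> powr (\<alpha> - 1)) (at x)"
      by (simp add: has_real_derivative_iff_has_vector_derivative abs_minus_commute)
  next
    show "continuous_on {a..b} ?F"
      using assms(1) by (intro continuous_on_divide continuous_on_const
          continuous_on_compose2[OF continuous_on_signed_powr[OF assms(1)], of "{a..b}" "\<lambda>x. x - s"] continuous_on_diff continuous_on_id) auto
  qed (use assms in auto)
  then have "(\<integral>\<^sup>+u. ennreal (\<bar>s - u\<bar> powr (\<alpha> - 1)) * indicator {a..b} u \<partial>lborel) = ennreal (?F b - ?F a)"
    by (rule nn_integral_has_integral_lebesgue'[rotated]) auto
  then show ?thesis by (simp add: diff_divide_distrib)
qed

lemma mono_signed_powr:
  assumes "0 < \<alpha>" "x \<le> y"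
  shows "sgn x * \<bar>x\<bar> powr \<alpha> \<le> sgn y * \<bar>y\<bar> powr (\<alpha>::real)"
proof -
  consider "0 \<le> x" | "x < 0" "0 \<le> y" | "y < 0" by linarith
  then show ?thesis
  proof cases
    case 1 then show ?thesis using assms by (auto simp: sgn_if intro!: powr_mono2)
  next
    case 2 then show ?thesis by (auto simp: sgn_if) (smt (verit) powr_ge_zero)
  next
    case 3
    then have "\<bar>y\<bar> powr \<alpha> \<le> \<bar>x\<bar> powr \<alpha>" using assms by (intro powr_mono2) auto
    then show ?thesis using 3 assms by (auto simp: sgn_if)
  qed
qed

text \<open>Integrating the signed power once more gives
  \<open>\<bar>x\<bar> powr (\<alpha> + 1)\<close>, where \<open>\<alpha> + 1 = 2 * H\<close>. The
  resulting second difference is also that of the covariance of two fBm increments, which links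
  energy to variance. Nonnegativity is recorded separately because \<open>ennreal\<close> would hide
  a negative value.\<close>

lemma nn_integral_riesz_rectangle:
  fixes a b x y \<alpha> :: real
  assumes \<alpha>: "0 < \<alpha>" and "a \<le> b" "x \<le> y"
  shows "(\<integral>\<^sup>+s. (\<integral>\<^sup>+u. ennreal (\<bar>s - u\<bar> powr (\<alpha> - 1)) * indicator {a..b} u \<partial>lborel) * indicator {x..y} s \<partial>lborel)
    = ennreal ((\<bar>y - a\<bar> powr (\<alpha> + 1) - \<bar>y - b\<bar> powr (\<alpha> + 1) - \<bar>x - a\<bar> powr (\<alpha> + 1) + \<bar>x - b\<bar> powr (\<alpha> + 1))
         / (\<alpha> * (\<alpha> + 1)))" (is "?L = ennreal ?R")
    and "0 \<le> (\<bar>y - a\<bar> powr (\<alpha> + 1) - \<bar>y - b\<bar> powr (\<alpha> + 1) - \<bar>x - a\<bar> powr (\<alpha> + 1) + \<bar>x - b\<bar> powr (\<alpha> + 1))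
         / (\<alpha> * (\<alpha> + 1))"
proof -
  let ?G = "\<lambda>s. (\<bar>s - a\<bar> powr (\<alpha> + 1) - \<bar>s - b\<bar> powr (\<alpha> + 1)) / (\<alpha> * (\<alpha> + 1))"
  let ?g = "\<lambda>s. (sgn (b - s) * \<bar>b - s\<bar> powr \<alpha> - sgn (a - s) * \<bar>a - s\<bar> powr \<alpha>) / \<alpha>"
  have G: "(?g has_integral ?G y - ?G x) {x..y}"
  proof (rule fundamental_theorem_of_calculus_interior_strong[of "{a, b}"])
    fix z assume "z \<in> {x<..<y} - {a, b}"
    then have z: "z - a \<noteq> 0" "z - b \<noteq> 0" by auto
    have lin: "((\<lambda>x. x - c) has_real_derivative 1) (at z)" for c by (auto intro!: derivative_eq_intros)
    have d: "((\<lambda>z. \<bar>z - c\<bar> powr (\<alpha> + 1)) has_real_derivative (\<alpha> + 1) * (sgn (z - c) * \<bar>z - c\<bar> powr \<alpha>)) (at z)"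
      if "z - c \<noteq> 0" for c
      using DERIV_chain2[where f = "\<lambda>x. \<bar>x\<bar> powr (\<alpha> + 1)" and g = "\<lambda>x. x - c" and s = UNIV and Db = 1, OF has_real_derivative_abs_powr[OF that] lin]
      by simp
    have "(?G has_real_derivative
        ((\<alpha> + 1) * (sgn (z - a) * \<bar>z - a\<bar> powr \<alpha>) - (\<alpha> + 1) * (sgn (z - b) * \<bar>z - b\<bar> powr \<alpha>)) / (\<alpha> * (\<alpha> + 1))) (at z)"
      by (intro DERIV_cdivide DERIV_diff d z)
    moreover have "((\<alpha> + 1) * (sgn (z - a) * \<bar>z - a\<bar> powr \<alpha>) - (\<alpha> + 1) * (sgn (z - b) * \<bar>z - b\<bar> powr \<alpha>)) / (\<alpha> * (\<alpha> + 1)) = ?g z"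
    proof -
      have "((\<alpha> + 1) * (sgn (z - a) * \<bar>z - a\<bar> powr \<alpha>) - (\<alpha> + 1) * (sgn (z - b) * \<bar>z - b\<bar> powr \<alpha>)) / (\<alpha> * (\<alpha> + 1))
        = (sgn (z - a) * \<bar>z - a\<bar> powr \<alpha> - sgn (z - b) * \<bar>z - b\<bar> powr \<alpha>) / \<alpha>"
        using \<alpha> by (simp add: divide_simps) (simp add: algebra_simps)
      moreover have "sgn (z - a) = - sgn (a - z)" "sgn (z - b) = - sgn (b - z)" by (auto simp: sgn_if)
      ultimately show ?thesis by (simp add: abs_minus_commute)
    qed
    ultimately show "(?G has_vector_derivative ?g z) (at z)"
      by (simp add: has_real_derivative_iff_has_vector_derivative)
  next
    show "continuous_on {x..y} ?G"
      using \<alpha> by (intro continuous_intros continuous_on_powr') auto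
  qed (use assms in auto)
  have nn: "0 \<le> ?g s" for s
    using mono_signed_powr[OF \<alpha>, of "a - s" "b - s"] assms by simp
  have eq: "?G y - ?G x = ?R" by (simp add: diff_divide_distrib add_divide_distrib)
  show "0 \<le> ?R" using has_integral_nonneg[OF G] nn eq by simp
  have "?L = (\<integral>\<^sup>+s. ennreal (?g s) * indicator {x..y} s \<partial>lborel)"
    by (subst nn_integral_riesz_interval) (use assms in auto)
  also have "\<dots> = ennreal (?G y - ?G x)"
    by (rule nn_integral_has_integral_lebesgue'[OF nn G])
  finally show "?L = ennreal ?R" using eq by simp
qed

section \<open>The Riesz energy as a squared L^2 norm, and its upper bound\<close>

text \<open>For \<open>\<alpha> = 2 * H - 1\<close> this is the squared norm of the space |H|: the
  first limit in \<open>wiener_integral_fbm\<close> says that the energies of the approximation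
  errors, cut off to \<open>{0..T}\<close>, tend to 0.\<close>

definition riesz_energy :: "real \<Rightarrow> (real \<Rightarrow> real) \<Rightarrow> ennreal" where
  "riesz_energy \<alpha> h =
     (\<integral>\<^sup>+s. \<integral>\<^sup>+u. ennreal (\<bar>h s\<bar> * \<bar>h u\<bar> * \<bar>s - u\<bar> powr (\<alpha> - 1)) \<partial>lborel \<partial>lborel)"

text \<open>The truncated power. For \<open>\<beta> = \<alpha> / 2 - 1\<close> it is, up to a Gamma
  factor, the kernel of a one-sided fractional integral of order \<open>\<alpha> / 2\<close>. The
  case split is needed because \<open>powr\<close> does not vanish at negative arguments.\<close>

definition pos_powr :: "real \<Rightarrow> real \<Rightarrow> real" where
  "pos_powr \<beta> y = (if 0 < y then y powr \<beta> else 0)"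

lemma pos_powr_measurable [measurable]: "pos_powr \<beta> \<in> borel_measurable borel"
  unfolding pos_powr_def by measurable

lemma pos_powr_nonneg [simp]: "0 \<le> pos_powr \<beta> y"
  by (simp add: pos_powr_def)

lemma pos_powr_mult: "0 < d \<Longrightarrow> pos_powr \<beta> (d * y) = d powr \<beta> * pos_powr \<beta> y"
  by (auto simp: pos_powr_def powr_mult zero_less_mult_iff)

text \<open>The constant is the Beta value B(\<alpha>/2, 1 - \<alpha>). Near 0 the integrand behaves
  like \<open>y powr \<beta>\<close> with \<open>\<beta> > -1\<close>, at infinity like
  \<open>y powr (\<alpha> - 2)\<close> with \<open>\<alpha> - 2 < -1\<close>. Both bounds serve to
  cancel the constant from an inequality later.\<close>

lemma riesz_kernel_constant:
  assumes "0 < \<alpha>" "\<alpha> < 1"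
  defines "\<beta> \<equiv> (\<alpha> - 2) / 2"
  defines "c \<equiv> \<integral>\<^sup>+y. ennreal (pos_powr \<beta> y * pos_powr \<beta> (1 + y)) \<partial>lborel"
  shows "0 < c" "c < \<infinity>"
proof -
  have \<beta>: "\<beta> < 0" "\<beta> = \<alpha> / 2 - 1" "\<beta> + \<beta> = \<alpha> - 2" using assms(1,2) by (auto simp: \<beta>_def field_simps)
  have "0 < ennreal (2 powr \<beta> * 3 powr \<beta>) * emeasure lborel {1..2::real}" by simp
  also have "\<dots> = (\<integral>\<^sup>+y. ennreal (2 powr \<beta> * 3 powr \<beta>) * indicator {1..2::real} y \<partial>lborel)"
    by (subst nn_integral_cmult_indicator) auto
  also have "\<dots> \<le> c"
    unfolding c_def
  proof (intro nn_integral_mono)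
    fix y :: real
    show "ennreal (2 powr \<beta> * 3 powr \<beta>) * indicator {1..2} y \<le> ennreal (pos_powr \<beta> y * pos_powr \<beta> (1 + y))"
      using \<beta>(1) by (auto simp: indicator_def pos_powr_def intro!: ennreal_leI mult_mono powr_mono2')
  qed
  finally show "0 < c" .
  have "c \<le> (\<integral>\<^sup>+y. ennreal (\<bar>0 - y\<bar> powr (\<alpha> / 2 - 1)) * indicator {0..1} y
      + ennreal (y powr (\<alpha> - 2)) * indicator {1..} y \<partial>lborel)"
    unfolding c_def
  proof (intro nn_integral_mono)
    fix y :: real
    consider "y \<le> 0" | "0 < y" "y \<le> 1" | "1 < y" by linarith
    then show "ennreal (pos_powr \<beta> y * pos_powr \<beta> (1 + y))
      \<le> ennreal (\<bar>0 - y\<bar> powr (\<alpha> / 2 - 1)) * indicator {0..1} y + ennreal (y powr (\<alpha> - 2)) * indicator {1..} y"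
    proof cases
      case 1 then show ?thesis by (simp add: pos_powr_def)
    next
      case 2
      have "(1 + y) powr \<beta> \<le> 1 powr \<beta>" using 2 \<beta> by (intro powr_mono2') auto
      then have "y powr \<beta> * (1 + y) powr \<beta> \<le> y powr \<beta> * 1" by (intro mult_left_mono) auto
      then show ?thesis using 2 by (auto simp: pos_powr_def \<beta>(2)[symmetric] intro!: add_increasing2 ennreal_leI)
    next
      case 3
      have "(1 + y) powr \<beta> \<le> y powr \<beta>" using 3 \<beta> by (intro powr_mono2') auto
      then have "y powr \<beta> * (1 + y) powr \<beta> \<le> y powr \<beta> * y powr \<beta>" by (intro mult_left_mono) auto
      also have "\<dots> = y powr (\<alpha> - 2)" using 3 \<beta>(3) by (simp add: powr_add[symmetric])
      finally show ?thesis using 3 by (auto simp: pos_powr_def intro!: ennreal_leI)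
    qed
  qed
  also have "\<dots> = (\<integral>\<^sup>+y. ennreal (\<bar>0 - y\<bar> powr (\<alpha> / 2 - 1)) * indicator {0..1} y \<partial>lborel)
      + (\<integral>\<^sup>+y. ennreal (y powr (\<alpha> - 2)) * indicator {1..} y \<partial>lborel)"
    by (intro nn_integral_add) auto
  finally have le: "c \<le> (\<integral>\<^sup>+y. ennreal (\<bar>0 - y\<bar> powr (\<alpha> / 2 - 1)) * indicator {0..1} y \<partial>lborel)
      + (\<integral>\<^sup>+y. ennreal (y powr (\<alpha> - 2)) * indicator {1..} y \<partial>lborel)" .
  have "(\<integral>\<^sup>+y. ennreal (\<bar>0 - y\<bar> powr (\<alpha> / 2 - 1)) * indicator {0..1} y \<partial>lborel) < \<infinity>"
    using nn_integral_riesz_interval[of "\<alpha> / 2" 0 1 0] assms(1) by simp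
  moreover have "(\<integral>\<^sup>+y. ennreal (y powr (\<alpha> - 2)) * indicator {1..} y \<partial>lborel) = ennreal (0 - 1 powr (\<alpha> - 1) / (\<alpha> - 1))"
  proof (rule nn_integral_FTC_atLeast[where F = "\<lambda>x. x powr (\<alpha> - 1) / (\<alpha> - 1)"])
    fix x :: real assume "1 \<le> x"
    then show "((\<lambda>x. x powr (\<alpha> - 1) / (\<alpha> - 1)) has_real_derivative x powr (\<alpha> - 2)) (at x)"
      using assms by (auto intro!: derivative_eq_intros)
  next
    have "((\<lambda>x. x powr (\<alpha> - 1) / (\<alpha> - 1)) \<longlongrightarrow> 0 / (\<alpha> - 1)) at_top"
      using assms by (intro tendsto_divide tendsto_neg_powr filterlim_ident tendsto_const) auto
    then show "((\<lambda>x. x powr (\<alpha> - 1) / (\<alpha> - 1)) \<longlongrightarrow> 0) at_top" by simp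
  qed auto
  ultimately show "c < \<infinity>" using le by (auto simp: less_top[symmetric] top_unique)
qed

text \<open>For \<open>s < u\<close> substitute \<open>z = s - d * y\<close> with
  \<open>d = u - s\<close>; scaling produces the exponent
  \<open>1 + 2 * \<beta> = \<alpha> - 1\<close>. The diagonal has to be excluded: there
  \<open>0 powr (\<alpha> - 1)\<close> is 0, while the integral on the left is infinite.\<close>

lemma riesz_kernel_factorization:
  assumes "0 < \<alpha>" "\<alpha> < 1" "s \<noteq> u"
  defines "\<beta> \<equiv> (\<alpha> - 2) / 2"
  defines "c \<equiv> \<integral>\<^sup>+y. ennreal (pos_powr \<beta> y * pos_powr \<beta> (1 + y)) \<partial>lborel"
  shows "(\<integral>\<^sup>+z. ennreal (pos_powr \<beta> (s - z) * pos_powr \<beta> (u - z)) \<partial>lborel) = c * ennreal (\<bar>s - u\<bar> powr (\<alpha> - 1))"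
proof -
  have *: "(\<integral>\<^sup>+z. ennreal (pos_powr \<beta> (s - z) * pos_powr \<beta> (u - z)) \<partial>lborel) = c * ennreal (\<bar>s - u\<bar> powr (\<alpha> - 1))"
    if "s < u" for s u
  proof -
    define d where "d = u - s"
    have d: "0 < d" using that by (simp add: d_def)
    have "(\<integral>\<^sup>+z. ennreal (pos_powr \<beta> (s - z) * pos_powr \<beta> (u - z)) \<partial>lborel)
      = ennreal d * (\<integral>\<^sup>+y. ennreal (pos_powr \<beta> (s - (s + (- d) * y)) * pos_powr \<beta> (u - (s + (- d) * y))) \<partial>lborel)"
      using d by (subst nn_integral_real_affine[where c = "- d" and t = s]) auto
    also have "(\<lambda>y. pos_powr \<beta> (s - (s + (- d) * y)) * pos_powr \<beta> (u - (s + (- d) * y)))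
      = (\<lambda>y. d powr \<beta> * d powr \<beta> * (pos_powr \<beta> y * pos_powr \<beta> (1 + y)))"
    proof
      fix y
      have "s - (s + (- d) * y) = d * y" "u - (s + (- d) * y) = d * (1 + y)" by (auto simp: d_def algebra_simps)
      then show "pos_powr \<beta> (s - (s + (- d) * y)) * pos_powr \<beta> (u - (s + (- d) * y))
        = d powr \<beta> * d powr \<beta> * (pos_powr \<beta> y * pos_powr \<beta> (1 + y))"
        using d by (simp add: pos_powr_mult)
    qed
    also have "(\<integral>\<^sup>+y. ennreal (d powr \<beta> * d powr \<beta> * (pos_powr \<beta> y * pos_powr \<beta> (1 + y))) \<partial>lborel)
      = ennreal (d powr \<beta> * d powr \<beta>) * c"
      unfolding c_def by (subst ennreal_mult'') (auto intro!: nn_integral_cmult)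
    also have "ennreal d * (ennreal (d powr \<beta> * d powr \<beta>) * c) = c * ennreal (d powr 1 * (d powr \<beta> * d powr \<beta>))"
      using d by (simp add: ennreal_mult mult_ac)
    also have "d powr 1 * (d powr \<beta> * d powr \<beta>) = \<bar>s - u\<bar> powr (\<alpha> - 1)"
      unfolding powr_add[symmetric] using d by (simp add: \<beta>_def d_def)
    finally show ?thesis .
  qed
  show ?thesis
  proof (cases "s < u")
    case False
    with *[of u s] assms(3) show ?thesis by (simp add: mult.commute abs_minus_commute)
  qed (use * in auto)
qed

text \<open>The energy is a squared \<open>L\<^sup>2\<close> norm, so it satisfies a triangle inequality even for integrands
  that are not step functions.\<close>
lemma riesz_energy_eq_square:
  assumes "0 < \<alpha>" "\<alpha> < 1" and [measurable]: "h \<in> borel_measurable borel"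
  defines "\<beta> \<equiv> (\<alpha> - 2) / 2"
  defines "c \<equiv> \<integral>\<^sup>+y. ennreal (pos_powr \<beta> y * pos_powr \<beta> (1 + y)) \<partial>lborel"
  shows "c * riesz_energy \<alpha> h = (\<integral>\<^sup>+z. (\<integral>\<^sup>+s. ennreal (\<bar>h s\<bar> * pos_powr \<beta> (s - z)) \<partial>lborel)\<^sup>2 \<partial>lborel)"
proof -
  let ?g = "\<lambda>z s. ennreal (\<bar>h s\<bar> * pos_powr \<beta> (s - z))"
  have "(\<integral>\<^sup>+z. (\<integral>\<^sup>+s. ?g z s \<partial>lborel)\<^sup>2 \<partial>lborel) = (\<integral>\<^sup>+z. \<integral>\<^sup>+s. \<integral>\<^sup>+u. ?g z s * ?g z u \<partial>lborel \<partial>lborel \<partial>lborel)"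
    by (simp add: power2_eq_square nn_integral_cmult nn_integral_multc)
  also have "\<dots> = (\<integral>\<^sup>+s. \<integral>\<^sup>+z. \<integral>\<^sup>+u. ?g z s * ?g z u \<partial>lborel \<partial>lborel \<partial>lborel)"
    by (rule lborel_pair.Fubini') measurable
  also have "\<dots> = (\<integral>\<^sup>+s. \<integral>\<^sup>+u. \<integral>\<^sup>+z. ?g z s * ?g z u \<partial>lborel \<partial>lborel \<partial>lborel)"
    by (intro nn_integral_cong lborel_pair.Fubini') measurable
  also have "\<dots> = (\<integral>\<^sup>+s. \<integral>\<^sup>+u. c * ennreal (\<bar>h s\<bar> * \<bar>h u\<bar> * \<bar>s - u\<bar> powr (\<alpha> - 1)) \<partial>lborel \<partial>lborel)"
  proof (rule nn_integral_cong, rule nn_integral_cong_AE)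
    fix s :: real
    \<comment> \<open>Tonelli has moved z innermost, so that the factorization applies; it fails
      only at \<open>u = s\<close>, a null set for each s.\<close>
    show "AE u in lborel. (\<integral>\<^sup>+z. ?g z s * ?g z u \<partial>lborel) = c * ennreal (\<bar>h s\<bar> * \<bar>h u\<bar> * \<bar>s - u\<bar> powr (\<alpha> - 1))"
      using AE_lborel_singleton[of s]
    proof eventually_elim
      case (elim u)
      have "(\<integral>\<^sup>+z. ?g z s * ?g z u \<partial>lborel)
        = (\<integral>\<^sup>+z. ennreal (\<bar>h s\<bar> * \<bar>h u\<bar>) * ennreal (pos_powr \<beta> (s - z) * pos_powr \<beta> (u - z)) \<partial>lborel)"
        by (intro nn_integral_cong) (simp add: ennreal_mult[symmetric] mult_ac)
      also have "\<dots> = ennreal (\<bar>h s\<bar> * \<bar>h u\<bar>) * (c * ennreal (\<bar>s - u\<bar> powr (\<alpha> - 1)))"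
        using riesz_kernel_factorization[OF assms(1,2), of s u] elim
        by (subst nn_integral_cmult) (auto simp: c_def \<beta>_def)
      finally show ?case by (simp add: ennreal_mult mult_ac)
    qed
  qed
  also have "\<dots> = c * riesz_energy \<alpha> h"
    unfolding riesz_energy_def by (subst nn_integral_cmult[symmetric]) (auto simp: nn_integral_cmult)
  finally show ?thesis by simp
qed

lemma ennreal_square_add_le: "(a + b)\<^sup>2 \<le> 2 * a\<^sup>2 + 2 * (b::ennreal)\<^sup>2"
proof (cases a; cases b)
  fix x y assume *: "a = ennreal x" "0 \<le> x" "b = ennreal y" "0 \<le> y"
  have "(x + y)\<^sup>2 \<le> 2 * x\<^sup>2 + 2 * y\<^sup>2" using sum_squares_bound[of x y] by (simp add: power2_sum)
  then have "ennreal ((x + y)\<^sup>2) \<le> ennreal (2 * x\<^sup>2 + 2 * y\<^sup>2)" by (rule ennreal_leI)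
  then show ?thesis using * by (simp add: ennreal_mult ennreal_power[symmetric])
qed (auto simp: power2_eq_square)

text \<open>Up to the constant \<open>c\<close>, the energy is the squared L^2 norm of a potential
  of the absolute value, and such potentials are subadditive. The form with factors 2 avoids square
  roots and covers infinite energies; \<open>c\<close> cancels because it is positive and
  finite.\<close>

lemma riesz_energy_add_le:
  assumes \<alpha>: "0 < \<alpha>" "\<alpha> < 1" and [measurable]: "f \<in> borel_measurable borel" "g \<in> borel_measurable borel"
  shows "riesz_energy \<alpha> (\<lambda>x. f x + g x) \<le> 2 * riesz_energy \<alpha> f + 2 * riesz_energy \<alpha> g"
proof -
  define \<beta> where "\<beta> = (\<alpha> - 2) / 2"
  define c where "c = (\<integral>\<^sup>+y. ennreal (pos_powr \<beta> y * pos_powr \<beta> (1 + y)) \<partial>lborel)"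
  have c: "0 < c" "c < \<infinity>" using riesz_kernel_constant[OF \<alpha>] by (auto simp: c_def \<beta>_def)
  let ?P = "\<lambda>h z. \<integral>\<^sup>+s. ennreal (\<bar>h s\<bar> * pos_powr \<beta> (s - z)) \<partial>lborel"
  have E: "c * riesz_energy \<alpha> h = (\<integral>\<^sup>+z. (?P h z)\<^sup>2 \<partial>lborel)" if "h \<in> borel_measurable borel" for h
    using riesz_energy_eq_square[OF \<alpha> that] by (simp add: c_def \<beta>_def)
  have "?P (\<lambda>x. f x + g x) z \<le> ?P f z + ?P g z" for z
  proof -
    have "?P (\<lambda>x. f x + g x) z \<le> (\<integral>\<^sup>+s. ennreal (\<bar>f s\<bar> * pos_powr \<beta> (s - z)) + ennreal (\<bar>g s\<bar> * pos_powr \<beta> (s - z)) \<partial>lborel)"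
      by (intro nn_integral_mono)
         (auto simp: ennreal_plus[symmetric] distrib_right[symmetric] simp del: ennreal_plus
           intro!: ennreal_leI mult_right_mono)
    also have "\<dots> = ?P f z + ?P g z" by (intro nn_integral_add) auto
    finally show ?thesis .
  qed
  then have le: "(?P (\<lambda>x. f x + g x) z)\<^sup>2 \<le> 2 * (?P f z)\<^sup>2 + 2 * (?P g z)\<^sup>2" for z
    by (intro order_trans[OF power_mono ennreal_square_add_le]) auto
  have "c * riesz_energy \<alpha> (\<lambda>x. f x + g x) = (\<integral>\<^sup>+z. (?P (\<lambda>x. f x + g x) z)\<^sup>2 \<partial>lborel)"
    by (rule E) measurable
  also have "\<dots> \<le> (\<integral>\<^sup>+z. 2 * (?P f z)\<^sup>2 + 2 * (?P g z)\<^sup>2 \<partial>lborel)"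
    by (intro nn_integral_mono le)
  also have "\<dots> = 2 * (\<integral>\<^sup>+z. (?P f z)\<^sup>2 \<partial>lborel) + 2 * (\<integral>\<^sup>+z. (?P g z)\<^sup>2 \<partial>lborel)"
    by (subst nn_integral_add) (auto simp: nn_integral_cmult)
  also have "\<dots> = c * (2 * riesz_energy \<alpha> f + 2 * riesz_energy \<alpha> g)"
    using E[of f] E[of g] by (simp add: distrib_left mult_ac flip: E)
  finally show ?thesis using c by (simp add: ennreal_mult_le_mult_iff)
qed

text \<open>A Schur test: by the arithmetic-geometric mean inequality the product
  \<open>\<bar>h s\<bar> * \<bar>h u\<bar>\<close> is replaced by squares in one variable each, so
  that only row integrals of the kernel remain.\<close>

lemma riesz_energy_le_square_integral:
  assumes \<alpha>: "0 < \<alpha>" and ab: "a \<le> b" and [measurable]: "h \<in> borel_measurable borel"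
    and h0: "\<And>x. x \<notin> {a..b} \<Longrightarrow> h x = 0"
  shows "riesz_energy \<alpha> h \<le> ennreal (2 * (b - a) powr \<alpha> / \<alpha>) * (\<integral>\<^sup>+x. ennreal ((h x)\<^sup>2) \<partial>lborel)"
proof -
  \<comment> \<open>Both indicators are put into the kernel because \<open>?F s u\<close> no longer
    contains \<open>h u\<close>, whose vanishing outside \<open>{a..b}\<close> would otherwise be
    lost.\<close>
  let ?k = "\<lambda>s u. ennreal (\<bar>s - u\<bar> powr (\<alpha> - 1)) * indicator {a..b} u * indicator {a..b} s"
  let ?F = "\<lambda>s u. ennreal ((h s)\<^sup>2 / 2) * ?k s u"
  have "riesz_energy \<alpha> h \<le> (\<integral>\<^sup>+s. \<integral>\<^sup>+u. ?F s u + ?F u s \<partial>lborel \<partial>lborel)"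
    unfolding riesz_energy_def
  proof (intro nn_integral_mono)
    fix s u :: real
    show "ennreal (\<bar>h s\<bar> * \<bar>h u\<bar> * \<bar>s - u\<bar> powr (\<alpha> - 1)) \<le> ?F s u + ?F u s"
    proof (cases "s \<in> {a..b} \<and> u \<in> {a..b}")
      case True
      have "\<bar>h s\<bar> * \<bar>h u\<bar> \<le> (h s)\<^sup>2 / 2 + (h u)\<^sup>2 / 2"
        using sum_squares_bound[of "\<bar>h s\<bar>" "\<bar>h u\<bar>"] by simp
      then have "\<bar>h s\<bar> * \<bar>h u\<bar> * \<bar>s - u\<bar> powr (\<alpha> - 1) \<le> ((h s)\<^sup>2 / 2 + (h u)\<^sup>2 / 2) * \<bar>s - u\<bar> powr (\<alpha> - 1)"
        by (intro mult_right_mono) auto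
      also have "\<dots> = (h s)\<^sup>2 / 2 * \<bar>s - u\<bar> powr (\<alpha> - 1) + (h u)\<^sup>2 / 2 * \<bar>u - s\<bar> powr (\<alpha> - 1)"
        by (simp add: distrib_right abs_minus_commute)
      finally have "ennreal (\<bar>h s\<bar> * \<bar>h u\<bar> * \<bar>s - u\<bar> powr (\<alpha> - 1))
        \<le> ennreal ((h s)\<^sup>2 / 2 * \<bar>s - u\<bar> powr (\<alpha> - 1) + (h u)\<^sup>2 / 2 * \<bar>u - s\<bar> powr (\<alpha> - 1))"
        by (rule ennreal_leI)
      also have "\<dots> = ennreal ((h s)\<^sup>2 / 2 * \<bar>s - u\<bar> powr (\<alpha> - 1)) + ennreal ((h u)\<^sup>2 / 2 * \<bar>u - s\<bar> powr (\<alpha> - 1))"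
        by (intro ennreal_plus) auto
      also have "ennreal ((h s)\<^sup>2 / 2 * \<bar>s - u\<bar> powr (\<alpha> - 1)) = ?F s u"
        using True by (subst ennreal_mult) auto
      also have "ennreal ((h u)\<^sup>2 / 2 * \<bar>u - s\<bar> powr (\<alpha> - 1)) = ?F u s"
        using True by (subst ennreal_mult) auto
      finally show ?thesis .
    next
      case False
      then have "h s = 0 \<or> h u = 0" using h0 by blast
      then show ?thesis by auto
    qed
  qed
  also have "\<dots> = (\<integral>\<^sup>+s. \<integral>\<^sup>+u. ?F s u \<partial>lborel \<partial>lborel) + (\<integral>\<^sup>+s. \<integral>\<^sup>+u. ?F u s \<partial>lborel \<partial>lborel)"
    by (simp add: nn_integral_add)
  also have "(\<integral>\<^sup>+s. \<integral>\<^sup>+u. ?F u s \<partial>lborel \<partial>lborel) = (\<integral>\<^sup>+s. \<integral>\<^sup>+u. ?F s u \<partial>lborel \<partial>lborel)"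
    by (rule lborel_pair.Fubini') measurable
  also have "(\<integral>\<^sup>+s. \<integral>\<^sup>+u. ?F s u \<partial>lborel \<partial>lborel) \<le> (\<integral>\<^sup>+s. ennreal (2 * (b - a) powr \<alpha> / \<alpha>) * ennreal ((h s)\<^sup>2 / 2) \<partial>lborel)"
  proof (intro nn_integral_mono)
    fix s :: real
    have "(\<integral>\<^sup>+u. ?F s u \<partial>lborel) = ennreal ((h s)\<^sup>2 / 2) * indicator {a..b} s * (\<integral>\<^sup>+u. ennreal (\<bar>s - u\<bar> powr (\<alpha> - 1)) * indicator {a..b} u \<partial>lborel)"
      by (subst nn_integral_cmult[symmetric]) (auto intro!: nn_integral_cong simp: mult_ac)
    also have "\<dots> \<le> ennreal (2 * (b - a) powr \<alpha> / \<alpha>) * ennreal ((h s)\<^sup>2 / 2)"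
    proof (cases "s \<in> {a..b}")
      case True
      have "(b - s) powr \<alpha> \<le> (b - a) powr \<alpha>" "(s - a) powr \<alpha> \<le> (b - a) powr \<alpha>"
        using True \<alpha> by (auto intro!: powr_mono2)
      moreover have "sgn (b - s) * \<bar>b - s\<bar> powr \<alpha> \<le> (b - s) powr \<alpha>" "- sgn (a - s) * \<bar>a - s\<bar> powr \<alpha> \<le> (s - a) powr \<alpha>"
        using True by (auto simp: sgn_if)
      ultimately have "(sgn (b - s) * \<bar>b - s\<bar> powr \<alpha> - sgn (a - s) * \<bar>a - s\<bar> powr \<alpha>) / \<alpha> \<le> 2 * (b - a) powr \<alpha> / \<alpha>"
        using \<alpha> by (intro divide_right_mono) auto
      then show ?thesis
        using True by (subst nn_integral_riesz_interval[OF \<alpha> ab])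
          (auto simp: mult.commute intro!: mult_left_mono ennreal_leI)
    qed auto
    finally show "(\<integral>\<^sup>+u. ?F s u \<partial>lborel) \<le> ennreal (2 * (b - a) powr \<alpha> / \<alpha>) * ennreal ((h s)\<^sup>2 / 2)" .
  qed
  also have "\<dots> = ennreal (2 * (b - a) powr \<alpha> / \<alpha>) * (\<integral>\<^sup>+s. ennreal ((h s)\<^sup>2 / 2) \<partial>lborel)"
    by (rule nn_integral_cmult) measurable
  finally have "riesz_energy \<alpha> h \<le> ennreal (2 * (b - a) powr \<alpha> / \<alpha>) *
     ((\<integral>\<^sup>+s. ennreal ((h s)\<^sup>2 / 2) \<partial>lborel) + (\<integral>\<^sup>+s. ennreal ((h s)\<^sup>2 / 2) \<partial>lborel))"
    by (simp add: distrib_left add_mono)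
  also have "(\<integral>\<^sup>+s. ennreal ((h s)\<^sup>2 / 2) \<partial>lborel) + (\<integral>\<^sup>+s. ennreal ((h s)\<^sup>2 / 2) \<partial>lborel) = (\<integral>\<^sup>+s. ennreal ((h s)\<^sup>2) \<partial>lborel)"
    by (subst nn_integral_add[symmetric]) (auto simp flip: ennreal_plus)
  finally show ?thesis .
qed

section \<open>Second moments of Wiener integrals\<close>

text \<open>Instead of differentiating the characteristic function, Levy uniqueness identifies the
  law with that of \<open>sqrt v\<close> times a standard normal variable; this covers
  \<open>v = 0\<close> as well. That v is nonnegative follows from the bound 1 on the modulus of a
  characteristic function, taken at \<open>u = 1\<close>.\<close>

lemma second_moment_of_char:
  assumes M: "prob_space M" and X[measurable]: "X \<in> borel_measurable M"
    and ch: "\<And>u. char (distr M borel X) u = complex_of_real (exp (- v * u\<^sup>2 / 2))"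
  shows "0 \<le> v" "(\<integral>\<^sup>+\<omega>. ennreal ((X \<omega>)\<^sup>2) \<partial>M) = ennreal v"
proof -
  interpret prob_space M by fact
  interpret D: real_distribution "distr M borel X" by (intro real_distribution_distr) simp
  have "norm (char (distr M borel X) 1) \<le> 1" by (rule D.cmod_char_le_1)
  then show v: "0 \<le> v" by (simp add: ch)
  interpret S: real_distribution std_normal_distribution by (rule real_dist_normal_dist)
  let ?N = "distr std_normal_distribution borel (\<lambda>x. sqrt v * x)"
  interpret N: real_distribution ?N
    by (intro S.real_distribution_distr) simp
  have "char (distr M borel X) = char ?N"
  proof
    fix u
    have "char ?N u = char std_normal_distribution (sqrt v * u)"
      by (simp add: char_def integral_distr mult_ac)
    also have "\<dots> = complex_of_real (exp (- v * u\<^sup>2 / 2))"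
      using v by (simp only: char_std_normal_distribution power_mult_distrib real_sqrt_pow2 mult_minus_left)
    finally show "char (distr M borel X) u = char ?N u" by (simp add: ch)
  qed
  then have eq: "distr M borel X = ?N"
    by (intro Levy_uniqueness D.real_distribution_axioms N.real_distribution_axioms)
  have "(\<integral>\<^sup>+\<omega>. ennreal ((X \<omega>)\<^sup>2) \<partial>M) = (\<integral>\<^sup>+x. ennreal (x\<^sup>2) \<partial>distr M borel X)"
    by (simp add: nn_integral_distr)
  also have "\<dots> = (\<integral>\<^sup>+x. ennreal ((sqrt v * x)\<^sup>2) \<partial>std_normal_distribution)"
    unfolding eq by (simp add: nn_integral_distr)
  also have "\<dots> = (\<integral>\<^sup>+x. ennreal v * ennreal (x^2) \<partial>std_normal_distribution)"
    using v by (simp add: power_mult_distrib ennreal_mult)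
  also have "\<dots> = ennreal v * (\<integral>\<^sup>+x. ennreal (x^2) \<partial>std_normal_distribution)"
    by (simp add: nn_integral_cmult)
  also have "(\<integral>\<^sup>+x. ennreal (x^2) \<partial>std_normal_distribution) = 1"
  proof -
    have "has_bochner_integral lborel (\<lambda>x. std_normal_density x * x ^ (2 * 1)) (fact (2 * 1) / (2 ^ 1 * fact 1))"
      by (rule std_normal_moment_even)
    then have "has_bochner_integral lborel (\<lambda>x. std_normal_density x * x\<^sup>2) 1" by simp
    then have "(\<integral>\<^sup>+x. ennreal (std_normal_density x * x\<^sup>2) \<partial>lborel) = ennreal 1"
      by (intro nn_integral_eq_integral[THEN trans])
         (auto simp: has_bochner_integral_iff normal_density_nonneg)
    then show ?thesis
      by (subst nn_integral_density) (auto simp: ennreal_mult normal_density_nonneg)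
  qed
  finally show "(\<integral>\<^sup>+\<omega>. ennreal ((X \<omega>)\<^sup>2) \<partial>M) = ennreal v" by simp
qed

text \<open>Sums over \<open>i < n\<close> are reindexed to an arbitrary finite index set, since the
  next applications index by pairs of an interval and one of its endpoints.\<close>

lemma fbm_combination_second_moment:
  assumes fbm: "is_fbm M H B" and A: "finite A" and t: "\<And>i. i \<in> A \<Longrightarrow> 0 \<le> t i"
  shows "(\<integral>\<^sup>+\<omega>. ennreal ((\<Sum>i\<in>A. c i * B (t i) \<omega>)\<^sup>2) \<partial>M)
    = ennreal (\<Sum>i\<in>A. \<Sum>j\<in>A. c i * c j * fbm_cov H (t i) (t j))"
proof -
  obtain e where e: "bij_betw e {..<card A} A"
    using ex_bij_betw_nat_finite[OF A] by (auto simp: atLeast0LessThan)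
  have M: "prob_space M" and [measurable]: "\<And>t. B t \<in> borel_measurable M"
    using fbm by (auto simp: is_fbm_def)
  have "\<forall>i<card A. 0 \<le> t (e i)" using bij_betwE[OF e] t by auto
  then have ch: "char (distr M borel (\<lambda>\<omega>. \<Sum>i<card A. c (e i) * B (t (e i)) \<omega>)) u =
             complex_of_real (exp (- (\<Sum>i<card A. \<Sum>j<card A. c (e i) * c (e j) * fbm_cov H (t (e i)) (t (e j))) * u\<^sup>2 / 2))" for u
    using fbm unfolding is_fbm_def by (auto dest!: spec[of _ "card A"] spec[of _ "\<lambda>i. t (e i)"] spec[of _ "\<lambda>i. c (e i)"])
  have "(\<Sum>i<card A. c (e i) * B (t (e i)) \<omega>) = (\<Sum>i\<in>A. c i * B (t i) \<omega>)" for \<omega>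
    by (rule sum.reindex_bij_betw[OF e])
  moreover have "(\<Sum>i<card A. \<Sum>j<card A. c (e i) * c (e j) * fbm_cov H (t (e i)) (t (e j)))
      = (\<Sum>i\<in>A. \<Sum>j\<in>A. c i * c j * fbm_cov H (t i) (t j))"
    by (subst sum.reindex_bij_betw[OF e, symmetric])
       (intro sum.cong refl sum.reindex_bij_betw[OF e])
  ultimately show ?thesis
    using second_moment_of_char(2)[OF M _ ch] by simp
qed

text \<open>The Bochner form is needed because these integrals get combined with signed
  coefficients. Passing between closed and half-open intervals changes null sets only.\<close>

lemma has_bochner_integral_riesz_rectangle:
  fixes a b x y \<alpha> :: real
  assumes \<alpha>: "0 < \<alpha>" and "a \<le> b" "x \<le> y"
  shows "has_bochner_integral (lborel \<Otimes>\<^sub>M lborel)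
    (\<lambda>(s, u). indicator {x..<y} s * indicator {a..<b} u * \<bar>s - u\<bar> powr (\<alpha> - 1))
    ((\<bar>y - a\<bar> powr (\<alpha> + 1) - \<bar>y - b\<bar> powr (\<alpha> + 1) - \<bar>x - a\<bar> powr (\<alpha> + 1) + \<bar>x - b\<bar> powr (\<alpha> + 1))
         / (\<alpha> * (\<alpha> + 1)))" (is "has_bochner_integral _ ?f ?q")
proof (rule has_bochner_integral_nn_integral)
  have "(\<integral>\<^sup>+z. ennreal (?f z) \<partial>(lborel \<Otimes>\<^sub>M lborel)) = (\<integral>\<^sup>+s. \<integral>\<^sup>+u. ennreal (?f (s, u)) \<partial>lborel \<partial>lborel)"
    by (rule lborel.nn_integral_fst[symmetric]) measurable
  also have "\<dots> = (\<integral>\<^sup>+s. (\<integral>\<^sup>+u. ennreal (\<bar>s - u\<bar> powr (\<alpha> - 1)) * indicator {a..b} u \<partial>lborel) * indicator {x..y} s \<partial>lborel)"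
    using AE_lborel_singleton[of y]
  proof (intro nn_integral_cong_AE, eventually_elim)
    case (elim s)
    have "(\<integral>\<^sup>+u. ennreal (?f (s, u)) \<partial>lborel) = (\<integral>\<^sup>+u. ennreal (\<bar>s - u\<bar> powr (\<alpha> - 1)) * indicator {a..b} u * indicator {x..y} s \<partial>lborel)"
    proof (rule nn_integral_cong_AE)
      show "AE u in lborel. ennreal (?f (s, u)) = ennreal (\<bar>s - u\<bar> powr (\<alpha> - 1)) * indicator {a..b} u * indicator {x..y} s"
        using AE_lborel_singleton[of b]
        by eventually_elim (use elim in \<open>auto simp: indicator_def\<close>)
    qed
    then show ?case by (simp add: nn_integral_multc)
  qed
  also have "\<dots> = ennreal ?q"
    by (rule nn_integral_riesz_rectangle[OF assms])
  finally show "(\<integral>\<^sup>+z. ennreal (?f z) \<partial>(lborel \<Otimes>\<^sub>M lborel)) = ennreal ?q" .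
  show "0 \<le> ?q" by (rule nn_integral_riesz_rectangle(2)[OF assms])
qed (auto simp: split_beta)

text \<open>The variance equals \<open>H * (2 * H - 1)\<close> times the signed double integral of
  the step function against the kernel; moving the absolute value inside gives the energy. The
  intervals may overlap, so that differences of step integrals over unrelated partitions are
  included.\<close>

lemma fbm_step_second_moment_le:
  assumes fbm: "is_fbm M H B" and H: "1/2 < H" and A: "finite A"
    and xy: "\<And>i. i \<in> A \<Longrightarrow> 0 \<le> x i \<and> x i \<le> y i"
  shows "(\<integral>\<^sup>+\<omega>. ennreal ((\<Sum>i\<in>A. c i * (B (y i) \<omega> - B (x i) \<omega>))\<^sup>2) \<partial>M)
    \<le> ennreal (H * (2 * H - 1)) * riesz_energy (2 * H - 1) (\<lambda>s. \<Sum>i\<in>A. c i * indicator {x i..<y i} s)"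
proof -
  define \<alpha> where "\<alpha> = 2 * H - 1"
  have \<alpha>: "0 < \<alpha>" "2 * H = \<alpha> + 1" "H * (2 * H - 1) = (\<alpha> + 1) / 2 * \<alpha>"
    using H by (auto simp: \<alpha>_def field_simps)
  let ?q = "\<lambda>i j. (\<bar>y i - x j\<bar> powr (\<alpha> + 1) - \<bar>y i - y j\<bar> powr (\<alpha> + 1) - \<bar>x i - x j\<bar> powr (\<alpha> + 1) + \<bar>x i - y j\<bar> powr (\<alpha> + 1))
         / (\<alpha> * (\<alpha> + 1))"
  let ?h = "\<lambda>s. \<Sum>i\<in>A. c i * indicator {x i..<y i} s"
  let ?S = "\<Sum>i\<in>A. \<Sum>j\<in>A. c i * c j * ?q i j"
  let ?f = "\<lambda>(s, u). ?h s * ?h u * \<bar>s - u\<bar> powr (\<alpha> - 1)"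
  \<comment> \<open>Each increment becomes two terms: the flag \<open>True\<close> stands for the
    right endpoint with coefficient \<open>c i\<close>, \<open>False\<close> for the left one with
    \<open>- c i\<close>.\<close>
  let ?c = "\<lambda>p. if snd p then c (fst p) else - c (fst p)"
  let ?t = "\<lambda>p. if snd p then y (fst p) else x (fst p)"
  have sum2: "(\<Sum>p\<in>A \<times> UNIV. g p) = (\<Sum>i\<in>A. g (i, True) + g (i, False))" for g :: "_ \<Rightarrow> real"
  proof -
    have "(\<Sum>p\<in>A \<times> UNIV. g p) = (\<Sum>i\<in>A. \<Sum>b\<in>UNIV. g (i, b))"
      by (simp add: sum.cartesian_product)
    then show ?thesis by (simp add: UNIV_bool add.commute)
  qed
  have "(\<integral>\<^sup>+\<omega>. ennreal ((\<Sum>i\<in>A. c i * (B (y i) \<omega> - B (x i) \<omega>))\<^sup>2) \<partial>M)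
      = (\<integral>\<^sup>+\<omega>. ennreal ((\<Sum>p\<in>A \<times> UNIV. ?c p * B (?t p) \<omega>)\<^sup>2) \<partial>M)"
    unfolding sum2 by (simp add: algebra_simps)
  also have "\<dots> = ennreal (\<Sum>p\<in>A \<times> UNIV. \<Sum>r\<in>A \<times> UNIV. ?c p * ?c r * fbm_cov H (?t p) (?t r))"
    using A xy order_trans[OF conjunct1[OF xy] conjunct2[OF xy]]
    by (intro fbm_combination_second_moment[OF fbm]) auto
  also have "(\<Sum>p\<in>A \<times> UNIV. \<Sum>r\<in>A \<times> UNIV. ?c p * ?c r * fbm_cov H (?t p) (?t r)) = H * (2 * H - 1) * ?S"
  proof -
    have Q: "H * (2 * H - 1) * (c i * c j * ?q i j)
        = c i * c j * (fbm_cov H (y i) (y j) - fbm_cov H (y i) (x j) - fbm_cov H (x i) (y j) + fbm_cov H (x i) (x j))" for i j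
    proof -
      have "H * (2 * H - 1) * ?q i j
        = (\<bar>y i - x j\<bar> powr (\<alpha> + 1) - \<bar>y i - y j\<bar> powr (\<alpha> + 1) - \<bar>x i - x j\<bar> powr (\<alpha> + 1) + \<bar>x i - y j\<bar> powr (\<alpha> + 1)) / 2"
        unfolding \<alpha>(3) using \<alpha>(1) by simp
      \<comment> \<open>The terms of the covariance that depend on one time only cancel in the
        second difference.\<close>
      also have "\<dots> = fbm_cov H (y i) (y j) - fbm_cov H (y i) (x j) - fbm_cov H (x i) (y j) + fbm_cov H (x i) (x j)"
        unfolding fbm_cov_def \<alpha>(2) by (simp add: abs_minus_commute add_divide_distrib diff_divide_distrib)
      finally show ?thesis by (simp only: mult.left_commute mult.assoc)
    qed
    show ?thesis
      unfolding sum2 sum_distrib_left Q sum.distrib[symmetric] by (intro sum.cong refl) (simp add: algebra_simps)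
  qed
  finally have eq: "(\<integral>\<^sup>+\<omega>. ennreal ((\<Sum>i\<in>A. c i * (B (y i) \<omega> - B (x i) \<omega>))\<^sup>2) \<partial>M) = ennreal (H * (2 * H - 1) * ?S)" .
  have eq': "ennreal (H * (2 * H - 1) * ?S) = ennreal (H * (2 * H - 1)) * ennreal ?S"
    using H by (intro ennreal_mult') simp
  have "ennreal ?S \<le> ennreal (norm ?S)"
    by (rule ennreal_leI) simp
  also have "ennreal (norm ?S) \<le> riesz_energy (2 * H - 1) ?h"
  proof -
    have "has_bochner_integral (lborel \<Otimes>\<^sub>M lborel)
      (\<lambda>z. \<Sum>i\<in>A. \<Sum>j\<in>A. c i * c j * (case z of (s, u) \<Rightarrow> indicator {x i..<y i} s * indicator {x j..<y j} u * \<bar>s - u\<bar> powr (\<alpha> - 1))) ?S"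
      using xy \<alpha>(1) by (intro has_bochner_integral_sum has_bochner_integral_mult_right has_bochner_integral_riesz_rectangle) auto
    also have "(\<lambda>z. \<Sum>i\<in>A. \<Sum>j\<in>A. c i * c j * (case z of (s, u) \<Rightarrow> indicator {x i..<y i} s * indicator {x j..<y j} u * \<bar>s - u\<bar> powr (\<alpha> - 1))) = ?f"
      by (rule ext) (simp only: split_beta sum_product, simp add: sum_distrib_left mult_ac)
    finally have f: "has_bochner_integral (lborel \<Otimes>\<^sub>M lborel) ?f ?S" .
    have "ennreal (norm (integral\<^sup>L (lborel \<Otimes>\<^sub>M lborel) ?f)) \<le> (\<integral>\<^sup>+z. norm (?f z) \<partial>(lborel \<Otimes>\<^sub>M lborel))"
      using f by (intro integral_norm_bound_ennreal) (auto simp: has_bochner_integral_iff)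
    also have "\<dots> = (\<integral>\<^sup>+s. \<integral>\<^sup>+u. norm (?f (s, u)) \<partial>lborel \<partial>lborel)"
      by (rule lborel.nn_integral_fst[symmetric]) measurable
    also have "\<dots> = riesz_energy (2 * H - 1) ?h"
      by (simp add: riesz_energy_def abs_mult \<alpha>_def)
    finally show ?thesis using f by (simp add: has_bochner_integral_iff)
  qed
  finally show ?thesis
    unfolding eq eq' by (rule mult_left_mono) simp
qed

section \<open>Mean square increments of Wiener integrals\<close>

text \<open>With it the second moment of \<open>I t\<close> is the case \<open>s = 0\<close> of the
  increment bound. The witness is the partition with no intervals, and the energy vanishes since the
  outer integral runs over a single point.\<close>

lemma wiener_integral_fbm_zero:
  assumes "is_fbm M H B"
  shows "wiener_integral_fbm M H B \<phi> 0 (\<lambda>_. 0)"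
proof -
  have "(\<integral>\<^sup>+s. \<integral>\<^sup>+u. ennreal (indicator {0..0} s * indicator {0..0} u * \<bar>0 - \<phi> s\<bar> * \<bar>0 - \<phi> u\<bar> * \<bar>s - u\<bar> powr (2*H - 2)) \<partial>lborel \<partial>lborel) = 0"
    (is "?L = 0")
  proof -
    have "AE s in lborel. (\<integral>\<^sup>+u. ennreal (indicator {0..0} s * indicator {0..0} u * \<bar>0 - \<phi> s\<bar> * \<bar>0 - \<phi> u\<bar> * \<bar>s - u\<bar> powr (2*H - 2)) \<partial>lborel) = 0"
      using AE_lborel_singleton[of "0::real"] by eventually_elim (simp add: indicator_def)
    then have "?L = (\<integral>\<^sup>+s. 0 \<partial>(lborel :: real measure))" by (rule nn_integral_cong_AE)
    then show ?thesis by simp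
  qed
  then show ?thesis
    unfolding wiener_integral_fbm_def Let_def
    by (intro conjI exI[of _ "\<lambda>_. 0"] exI[of _ "\<lambda>_ _. 0"]) simp_all
qed

text \<open>The difference of the two step approximations is a step function on the union of both
  partitions and equals \<phi> on \<open>{S<..T}\<close> plus two errors of vanishing energy. Hence
  its second moment is controlled by the energy of \<phi> on \<open>{S<..T}\<close> alone, and the
  bound passes to the limit.\<close>

lemma wiener_integral_fbm_increment_le:
  assumes fbm: "is_fbm M H B" and H: "1/2 < H" "H < 1" and ST: "0 \<le> S" "S \<le> T"
    and I: "wiener_integral_fbm M H B \<phi> T I" and J: "wiener_integral_fbm M H B \<phi> S J"
    and \<phi>: "set_borel_measurable borel {0..T} \<phi>"
  shows "(\<integral>\<^sup>+\<omega>. ennreal ((I \<omega> - J \<omega>)\<^sup>2) \<partial>M)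
    \<le> ennreal (16 * H * (T - S) powr (2 * H - 1)) * (\<integral>\<^sup>+s. ennreal ((indicator {S<..T} s * \<phi> s)\<^sup>2) \<partial>lborel)"
proof -
  define \<alpha> where "\<alpha> = 2 * H - 1"
  have \<alpha>: "0 < \<alpha>" "\<alpha> < 1" using H by (auto simp: \<alpha>_def)
  have [measurable]: "\<And>t. B t \<in> borel_measurable M" using fbm by (auto simp: is_fbm_def)
  obtain n x c where x: "\<And>k. x k 0 = 0" "\<And>k. x k (n k) = T" "\<And>k i. i < n k \<Longrightarrow> x k i \<le> x k (Suc i)"
    and "((\<lambda>k. \<integral>\<^sup>+ s. \<integral>\<^sup>+ u. ennreal (indicator {0..T} s * indicator {0..T} u *
                 \<bar>(\<Sum>i<n k. c k i * indicator {x k i ..< x k (Suc i)} s) - \<phi> s\<bar> * \<bar>(\<Sum>i<n k. c k i * indicator {x k i ..< x k (Suc i)} u) - \<phi> u\<bar> * \<bar>s - u\<bar> powr (2*H - 2)) \<partial>lborel \<partial>lborel)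
             \<longlonglongrightarrow> 0)"
    and F: "((\<lambda>k. \<integral>\<^sup>+ \<omega>. ennreal (((\<Sum>i<n k. c k i * (B (x k (Suc i)) \<omega> - B (x k i) \<omega>)) - I \<omega>)\<^sup>2) \<partial>M) \<longlonglongrightarrow> 0)"
    and [measurable]: "I \<in> borel_measurable M"
    using I unfolding wiener_integral_fbm_def Let_def by blast
  obtain m y d where y: "\<And>k. y k 0 = 0" "\<And>k. y k (m k) = S" "\<And>k i. i < m k \<Longrightarrow> y k i \<le> y k (Suc i)"
    and "((\<lambda>k. \<integral>\<^sup>+ s. \<integral>\<^sup>+ u. ennreal (indicator {0..S} s * indicator {0..S} u *
                 \<bar>(\<Sum>i<m k. d k i * indicator {y k i ..< y k (Suc i)} s) - \<phi> s\<bar> * \<bar>(\<Sum>i<m k. d k i * indicator {y k i ..< y k (Suc i)} u) - \<phi> u\<bar> * \<bar>s - u\<bar> powr (2*H - 2)) \<partial>lborel \<partial>lborel)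
             \<longlonglongrightarrow> 0)"
    and G: "((\<lambda>k. \<integral>\<^sup>+ \<omega>. ennreal (((\<Sum>i<m k. d k i * (B (y k (Suc i)) \<omega> - B (y k i) \<omega>)) - J \<omega>)\<^sup>2) \<partial>M) \<longlonglongrightarrow> 0)"
    and [measurable]: "J \<in> borel_measurable M"
    using J unfolding wiener_integral_fbm_def Let_def by blast
  let ?f = "\<lambda>k s. \<Sum>i<n k. c k i * indicator {x k i ..< x k (Suc i)} s"
  let ?g = "\<lambda>k s. \<Sum>i<m k. d k i * indicator {y k i ..< y k (Suc i)} s"
  let ?F = "\<lambda>k \<omega>. \<Sum>i<n k. c k i * (B (x k (Suc i)) \<omega> - B (x k i) \<omega>)"
  let ?G = "\<lambda>k \<omega>. \<Sum>i<m k. d k i * (B (y k (Suc i)) \<omega> - B (y k i) \<omega>)"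
  let ?e = "\<lambda>k s. indicator {0..T} s * (?f k s - \<phi> s)"
  \<comment> \<open>The minus sign makes \<open>?f k - ?g k\<close> the plain sum of
    \<open>?p\<close>, \<open>?e k\<close> and \<open>?e' k\<close>, as the energy bound for sums
    requires.\<close>
  let ?e' = "\<lambda>k s. - (indicator {0..S} s * (?g k s - \<phi> s))"
  let ?p = "\<lambda>s. indicator {S<..T} s * \<phi> s"
  have e: "(\<lambda>k. riesz_energy \<alpha> (?e k)) \<longlonglongrightarrow> 0" and e': "(\<lambda>k. riesz_energy \<alpha> (?e' k)) \<longlonglongrightarrow> 0"
    using \<open>(\<lambda>k. \<integral>\<^sup>+ s. \<integral>\<^sup>+ u. ennreal (indicator {0..T} s * _ * _ * _ * _) \<partial>lborel \<partial>lborel) \<longlonglongrightarrow> 0\<close>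
      \<open>(\<lambda>k. \<integral>\<^sup>+ s. \<integral>\<^sup>+ u. ennreal (indicator {0..S} s * _ * _ * _ * _) \<partial>lborel \<partial>lborel) \<longlonglongrightarrow> 0\<close>
    by (auto simp: riesz_energy_def \<alpha>_def abs_mult mult_ac)
  have sub: "(\<lambda>s. indicator C s * \<phi> s) \<in> borel_measurable borel" if "C \<in> sets borel" "C \<subseteq> {0..T}" for C
    using set_borel_measurable_subset[of borel "{0..T}" \<phi> C] \<phi> that by (simp add: set_borel_measurable_def)
  have [measurable]: "?p \<in> borel_measurable borel" by (rule sub) (use ST in auto)
  have [measurable]: "(\<lambda>s. indicator {0..T} s * \<phi> s) \<in> borel_measurable borel" "(\<lambda>s. indicator {0..S} s * \<phi> s) \<in> borel_measurable borel"
    by (rule sub; use ST in auto)+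
  \<comment> \<open>Only the products of \<phi> with indicators are known to be measurable, so the
    difference is multiplied out first.\<close>
  have me[measurable]: "?e k \<in> borel_measurable borel" "?e' k \<in> borel_measurable borel" for k
    unfolding right_diff_distrib by measurable
  have x_bounds: "0 \<le> x k i \<and> x k i \<le> T" if "i \<le> n k" for k i
  proof
    show "0 \<le> x k i" using that
    proof (induction i)
      case (Suc i) then show ?case using x(3)[of i k] by auto
    qed (simp add: x)
    show "x k i \<le> T"
      using that
    proof (induction rule: inc_induct)
      case (step i) then show ?case using x(3)[of i k] by auto
    qed (simp add: x)
  qed
  have y_bounds: "0 \<le> y k i \<and> y k i \<le> S" if "i \<le> m k" for k i
  proof
    show "0 \<le> y k i" using that
    proof (induction i)
      case (Suc i) then show ?case using y(3)[of i k] by auto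
    qed (simp add: y)
    show "y k i \<le> S"
      using that
    proof (induction rule: inc_induct)
      case (step i) then show ?case using y(3)[of i k] by auto
    qed (simp add: y)
  qed
  have f0: "?f k s = 0" if "s \<notin> {0..T}" for k s
  proof (intro sum.neutral ballI)
    fix i assume "i \<in> {..<n k}"
    then have "0 \<le> x k i" "x k (Suc i) \<le> T" using x_bounds[of i k] x_bounds[of "Suc i" k] by auto
    then show "c k i * indicator {x k i..<x k (Suc i)} s = 0" using that by auto
  qed
  have g0: "?g k s = 0" if "s \<notin> {0..S}" for k s
  proof (intro sum.neutral ballI)
    fix i assume "i \<in> {..<m k}"
    then have "0 \<le> y k i" "y k (Suc i) \<le> S" using y_bounds[of i k] y_bounds[of "Suc i" k] by auto
    then show "d k i * indicator {y k i..<y k (Suc i)} s = 0" using that by auto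
  qed
  have FG: "(\<integral>\<^sup>+\<omega>. ennreal ((?F k \<omega> - ?G k \<omega>)\<^sup>2) \<partial>M)
     \<le> ennreal (H * (2 * H - 1)) * (2 * riesz_energy \<alpha> ?p + 2 * (2 * riesz_energy \<alpha> (?e k) + 2 * riesz_energy \<alpha> (?e' k)))" for k
  proof -
    \<comment> \<open>The disjoint sum of the index sets keeps the intervals of both partitions; no
      common refinement is needed.\<close>
    let ?A = "{..<n k} <+> {..<m k}"
    let ?c = "case_sum (c k) (\<lambda>i. - d k i)"
    let ?x = "case_sum (x k) (y k)" and ?y = "case_sum (\<lambda>i. x k (Suc i)) (\<lambda>i. y k (Suc i))"
    have "(\<integral>\<^sup>+\<omega>. ennreal ((?F k \<omega> - ?G k \<omega>)\<^sup>2) \<partial>M) = (\<integral>\<^sup>+\<omega>. ennreal ((\<Sum>i\<in>?A. ?c i * (B (?y i) \<omega> - B (?x i) \<omega>))\<^sup>2) \<partial>M)"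
      by (simp add: sum.Plus sum_negf)
    also have "\<dots> \<le> ennreal (H * (2 * H - 1)) * riesz_energy (2 * H - 1) (\<lambda>s. \<Sum>i\<in>?A. ?c i * indicator {?x i..<?y i} s)"
      using x(3) y(3) x_bounds y_bounds
      by (intro fbm_step_second_moment_le[OF fbm H(1)]) (auto simp: less_imp_le)
    also have "(\<lambda>s. \<Sum>i\<in>?A. ?c i * indicator {?x i..<?y i} s) = (\<lambda>s. ?p s + (?e k s + ?e' k s))"
    proof
      fix s
      have "(\<Sum>i\<in>?A. ?c i * indicator {?x i..<?y i} s) = ?f k s - ?g k s"
        by (simp only: sum.Plus finite_lessThan o_def sum.case mult_minus_left sum_negf add_uminus_conv_diff)
      also have "\<dots> = ?p s + (?e k s + ?e' k s)"
      proof (cases "s \<in> {0..T}")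
        case True
        then show ?thesis using g0[of s k] ST by (cases "s \<in> {0..S}") auto
      next
        case False
        then have "s \<notin> {0..S}" "s \<notin> {S<..T}" using ST by auto
        then show ?thesis using g0[of s k] f0[of s k] False by simp
      qed
      finally show "(\<Sum>i\<in>?A. ?c i * indicator {?x i..<?y i} s) = ?p s + (?e k s + ?e' k s)" .
    qed
    also have "riesz_energy (2 * H - 1) (\<lambda>s. ?p s + (?e k s + ?e' k s))
      \<le> 2 * riesz_energy \<alpha> ?p + 2 * riesz_energy \<alpha> (\<lambda>s. ?e k s + ?e' k s)"
      unfolding \<alpha>_def[symmetric] by (intro riesz_energy_add_le[OF \<alpha>] borel_measurable_add me) measurable
    also have "riesz_energy \<alpha> (\<lambda>s. ?e k s + ?e' k s) \<le> 2 * riesz_energy \<alpha> (?e k) + 2 * riesz_energy \<alpha> (?e' k)"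
      by (intro riesz_energy_add_le[OF \<alpha>] me)
    finally show ?thesis by (simp add: mult_left_mono add_left_mono)
  qed
  let ?R = "\<lambda>k. 2 * (\<integral>\<^sup>+\<omega>. ennreal ((?F k \<omega> - I \<omega>)\<^sup>2) \<partial>M)
      + 2 * (2 * (ennreal (H * (2 * H - 1)) * (2 * riesz_energy \<alpha> ?p + 2 * (2 * riesz_energy \<alpha> (?e k) + 2 * riesz_energy \<alpha> (?e' k))))
        + 2 * (\<integral>\<^sup>+\<omega>. ennreal ((?G k \<omega> - J \<omega>)\<^sup>2) \<partial>M))"
  have le: "(\<integral>\<^sup>+\<omega>. ennreal ((I \<omega> - J \<omega>)\<^sup>2) \<partial>M) \<le> ?R k" for k
  proof -
    have sq: "(a + b)\<^sup>2 \<le> 2 * a\<^sup>2 + 2 * b\<^sup>2" for a b :: real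
      using sum_squares_bound[of a b] by (simp add: power2_sum)
    have "(\<integral>\<^sup>+\<omega>. ennreal ((I \<omega> - J \<omega>)\<^sup>2) \<partial>M) \<le> (\<integral>\<^sup>+\<omega>. 2 * ennreal ((?F k \<omega> - I \<omega>)\<^sup>2)
      + 2 * (2 * ennreal ((?F k \<omega> - ?G k \<omega>)\<^sup>2) + 2 * ennreal ((?G k \<omega> - J \<omega>)\<^sup>2)) \<partial>M)"
    proof (intro nn_integral_mono)
      fix \<omega>
      have "(I \<omega> - J \<omega>)\<^sup>2 = ((I \<omega> - ?F k \<omega>) + ((?F k \<omega> - ?G k \<omega>) + (?G k \<omega> - J \<omega>)))\<^sup>2" by simp
      also have "\<dots> \<le> 2 * (I \<omega> - ?F k \<omega>)\<^sup>2 + 2 * ((?F k \<omega> - ?G k \<omega>) + (?G k \<omega> - J \<omega>))\<^sup>2" by (rule sq)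
      also have "\<dots> \<le> 2 * (I \<omega> - ?F k \<omega>)\<^sup>2 + 2 * (2 * (?F k \<omega> - ?G k \<omega>)\<^sup>2 + 2 * (?G k \<omega> - J \<omega>)\<^sup>2)"
        by (intro add_left_mono mult_left_mono sq) auto
      also have "(I \<omega> - ?F k \<omega>)\<^sup>2 = (?F k \<omega> - I \<omega>)\<^sup>2" by (rule power2_commute)
      finally have "ennreal ((I \<omega> - J \<omega>)\<^sup>2) \<le> ennreal (2 * (?F k \<omega> - I \<omega>)\<^sup>2 + 2 * (2 * (?F k \<omega> - ?G k \<omega>)\<^sup>2 + 2 * (?G k \<omega> - J \<omega>)\<^sup>2))"
        by (rule ennreal_leI)
      then show "ennreal ((I \<omega> - J \<omega>)\<^sup>2) \<le> 2 * ennreal ((?F k \<omega> - I \<omega>)\<^sup>2)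
          + 2 * (2 * ennreal ((?F k \<omega> - ?G k \<omega>)\<^sup>2) + 2 * ennreal ((?G k \<omega> - J \<omega>)\<^sup>2))"
        by (simp add: ennreal_mult)
    qed
    also have "\<dots> = 2 * (\<integral>\<^sup>+\<omega>. ennreal ((?F k \<omega> - I \<omega>)\<^sup>2) \<partial>M)
      + 2 * (2 * (\<integral>\<^sup>+\<omega>. ennreal ((?F k \<omega> - ?G k \<omega>)\<^sup>2) \<partial>M) + 2 * (\<integral>\<^sup>+\<omega>. ennreal ((?G k \<omega> - J \<omega>)\<^sup>2) \<partial>M))"
      by (simp add: nn_integral_add nn_integral_cmult)
    also have "\<dots> \<le> ?R k"
      by (intro add_mono mult_left_mono FG order_refl) auto
    finally show ?thesis .
  qed
  \<comment> \<open>Three splittings of squares, each costing a factor 2, leave 8 times the energy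
    of \<open>?p\<close>. With the row integral bound,
    \<open>8 * H * (2 * H - 1) * 2 / \<alpha>\<close> is the constant \<open>16 * H\<close>.\<close>
  have "?R \<longlonglongrightarrow> 2 * 0 + 2 * (2 * (ennreal (H * (2 * H - 1)) * (2 * riesz_energy \<alpha> ?p + 2 * (2 * 0 + 2 * 0))) + 2 * 0)"
    by (intro tendsto_add ennreal_tendsto_cmult e e' F G tendsto_const) auto
  then have "(\<integral>\<^sup>+\<omega>. ennreal ((I \<omega> - J \<omega>)\<^sup>2) \<partial>M) \<le> 8 * ennreal (H * (2 * H - 1)) * riesz_energy \<alpha> ?p"
    using le by (intro LIMSEQ_le_const[where X = ?R]) (auto simp: mult_ac)
  also have "riesz_energy \<alpha> ?p \<le> ennreal (2 * (T - S) powr \<alpha> / \<alpha>) * (\<integral>\<^sup>+s. ennreal ((?p s)\<^sup>2) \<partial>lborel)"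
    using ST by (intro riesz_energy_le_square_integral \<alpha>) auto
  finally have "(\<integral>\<^sup>+\<omega>. ennreal ((I \<omega> - J \<omega>)\<^sup>2) \<partial>M)
    \<le> (8 * ennreal (H * (2 * H - 1)) * ennreal (2 * (T - S) powr \<alpha> / \<alpha>)) * (\<integral>\<^sup>+s. ennreal ((?p s)\<^sup>2) \<partial>lborel)"
    by (simp add: mult_left_mono mult.assoc)
  also have "8 * ennreal (H * (2 * H - 1)) * ennreal (2 * (T - S) powr \<alpha> / \<alpha>) = ennreal (8 * (H * (2 * H - 1)) * (2 * (T - S) powr \<alpha> / \<alpha>))"
    using H \<alpha> by (subst ennreal_mult) (auto simp: ennreal_mult intro!: divide_nonneg_pos)
  also have "8 * (H * (2 * H - 1)) * (2 * (T - S) powr \<alpha> / \<alpha>) = 16 * H * (T - S) powr (2 * H - 1)"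
    using H unfolding \<alpha>_def by simp
  finally show ?thesis .
qed

section \<open>Chaining and dyadic blocks\<close>

text \<open>A weighted Cauchy-Schwarz inequality along the dyadic approximations of w. The level
  sums have mean at most \<open>A * r ^ m * r ^ m\<close>; one factor \<open>r ^ m\<close> is spent
  on the weights, the other keeps the series summable, and each yields one factor
  \<open>1 / (1 - r)\<close>. The dominating Z is a countable sum, so no measurability of an
  uncountable supremum is involved; continuity of a path enters only when the bound is extended from
  dyadic points.\<close>

lemma dyadic_chaining:
  fixes J :: "real \<Rightarrow> 'a \<Rightarrow> real"
  assumes \<alpha>: "0 < \<alpha>" and A: "0 \<le> A"
    and meas: "\<And>w. w \<in> {0..1} \<Longrightarrow> J w \<in> borel_measurable M"
    and incr: "\<And>v w. 0 \<le> v \<Longrightarrow> v \<le> w \<Longrightarrow> w \<le> 1 \<Longrightarrow>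
      (\<integral>\<^sup>+\<omega>. ennreal ((J w \<omega> - J v \<omega>)\<^sup>2) \<partial>M) \<le> ennreal (A * (w - v) powr (1 + \<alpha>))"
  shows "\<exists>Z. Z \<in> borel_measurable M \<and> (\<integral>\<^sup>+\<omega>. Z \<omega> \<partial>M) \<le> ennreal (A / (1 - 2 powr (- \<alpha> / 2))\<^sup>2) \<and>
    (\<forall>\<omega>. continuous_on {0..1} (\<lambda>w. J w \<omega>) \<longrightarrow> (\<forall>w\<in>{0..1}. ennreal ((J w \<omega> - J 0 \<omega>)\<^sup>2) \<le> Z \<omega>))"
proof -
  define r :: real where "r = 2 powr (- \<alpha> / 2)"
  have "(2::real) powr (- \<alpha> / 2) < 2 powr 0" using \<alpha> by (intro powr_less_mono) auto
  then have r: "0 < r" "r < 1" by (auto simp: r_def)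
  define \<Delta> where "\<Delta> m k \<omega> = (J (real (Suc k) / 2 ^ m) \<omega> - J (real k / 2 ^ m) \<omega>)\<^sup>2" for m k :: nat and \<omega>
  define S where "S m \<omega> = (\<Sum>k<2 ^ m. \<Delta> m k \<omega>)" for m :: nat and \<omega>
  define Z where "Z \<omega> = ennreal (1 / (1 - r)) * (\<Sum>m. ennreal (S m \<omega> / r ^ m))" for \<omega>
  have grid: "real k / 2 ^ m \<in> {0..1}" if "k \<le> 2 ^ m" for k m :: nat
  proof -
    have "real k \<le> real (2 ^ m)" using that by (simp only: of_nat_le_iff)
    then show ?thesis by simp
  qed
  have \<Delta>_meas: "\<Delta> m k \<in> borel_measurable M" if "k < 2 ^ m" for m k
    using meas[OF grid[of k m]] meas[OF grid[of "Suc k" m]] that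
    unfolding \<Delta>_def by (intro borel_measurable_power borel_measurable_diff) auto
  have S_meas[measurable]: "S m \<in> borel_measurable M" for m
    unfolding S_def by (intro borel_measurable_sum \<Delta>_meas) auto
  have \<Delta>_nonneg: "0 \<le> \<Delta> m k \<omega>" and S_nonneg: "0 \<le> S m \<omega>" for m k \<omega>
    by (auto simp: \<Delta>_def S_def intro!: sum_nonneg)
  have Z_meas: "Z \<in> borel_measurable M" unfolding Z_def by measurable
  have S_int: "(\<integral>\<^sup>+\<omega>. ennreal (S m \<omega> / r ^ m) \<partial>M) \<le> ennreal (A * r ^ m)" for m
  proof -
    have "(\<integral>\<^sup>+\<omega>. ennreal (S m \<omega>) \<partial>M) = (\<integral>\<^sup>+\<omega>. (\<Sum>k<2 ^ m. ennreal (\<Delta> m k \<omega>)) \<partial>M)"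
      by (simp add: S_def \<Delta>_nonneg)
    also have "\<dots> = (\<Sum>k<2 ^ m. \<integral>\<^sup>+\<omega>. ennreal (\<Delta> m k \<omega>) \<partial>M)"
      using \<Delta>_meas by (intro nn_integral_sum) auto
    also have "\<dots> \<le> (\<Sum>k<(2::nat) ^ m. ennreal (A * (1 / 2 ^ m) powr (1 + \<alpha>)))"
    proof (intro sum_mono)
      fix k assume "k \<in> {..<(2::nat) ^ m}"
      then have "(\<integral>\<^sup>+\<omega>. ennreal (\<Delta> m k \<omega>) \<partial>M) \<le> ennreal (A * (real (Suc k) / 2 ^ m - real k / 2 ^ m) powr (1 + \<alpha>))"
        using grid[of k m] grid[of "Suc k" m] unfolding \<Delta>_def by (intro incr) (auto intro!: divide_right_mono)
      then show "(\<integral>\<^sup>+\<omega>. ennreal (\<Delta> m k \<omega>) \<partial>M) \<le> ennreal (A * (1 / 2 ^ m) powr (1 + \<alpha>))"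
        by (simp add: diff_divide_distrib[symmetric])
    qed
    also have "\<dots> = ennreal (2 ^ m * (A * (1 / 2 ^ m) powr (1 + \<alpha>)))"
      using A by (simp add: ennreal_mult ennreal_power[symmetric] flip: ennreal_numeral)
    also have "2 ^ m * (A * (1 / 2 ^ m) powr (1 + \<alpha>)) = A * r ^ m * r ^ m"
    proof -
      have "(1 / 2 ^ m) powr (1 + \<alpha>) = (1 / 2 ^ m) * (1 / 2 ^ m :: real) powr \<alpha>"
        by (simp add: powr_add)
      also have "(1 / 2 ^ m :: real) powr \<alpha> = r ^ m * r ^ m"
      proof -
        have "(1 / 2 ^ m :: real) = 2 powr (- real m)" by (simp add: powr_minus powr_realpow divide_inverse)
        then have "(1 / 2 ^ m :: real) powr \<alpha> = 2 powr (- real m * \<alpha>)" by (simp add: powr_powr)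
        also have "\<dots> = (r powr real m) * (r powr real m)"
          by (simp add: r_def powr_powr powr_add[symmetric] mult.commute)
        finally show ?thesis using r by (simp add: powr_realpow)
      qed
      finally show ?thesis by simp
    qed
    finally have *: "(\<integral>\<^sup>+\<omega>. ennreal (S m \<omega>) \<partial>M) \<le> ennreal (A * r ^ m * r ^ m)" .
    have "(\<integral>\<^sup>+\<omega>. ennreal (S m \<omega> / r ^ m) \<partial>M) = ennreal (1 / r ^ m) * (\<integral>\<^sup>+\<omega>. ennreal (S m \<omega>) \<partial>M)"
      using r S_nonneg by (subst nn_integral_cmult[symmetric]) (auto simp: ennreal_mult[symmetric])
    also have "\<dots> \<le> ennreal (1 / r ^ m) * ennreal (A * r ^ m * r ^ m)"
      by (intro mult_left_mono *) auto
    also have "\<dots> = ennreal (A * r ^ m)" using r A by (simp add: ennreal_mult[symmetric])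
    finally show ?thesis .
  qed
  have "(\<integral>\<^sup>+\<omega>. Z \<omega> \<partial>M) = ennreal (1 / (1 - r)) * (\<Sum>m. \<integral>\<^sup>+\<omega>. ennreal (S m \<omega> / r ^ m) \<partial>M)"
    unfolding Z_def by (subst nn_integral_cmult, measurable, subst nn_integral_suminf) auto
  also have "\<dots> \<le> ennreal (1 / (1 - r)) * (\<Sum>m. ennreal (A * r ^ m))"
    by (intro mult_left_mono suminf_le S_int summableI) auto
  also have "(\<Sum>m. ennreal (A * r ^ m)) = ennreal (A * (1 / (1 - r)))"
    using r A by (intro suminf_ennreal_eq sums_mult geometric_sums) auto
  also have "ennreal (1 / (1 - r)) * ennreal (A * (1 / (1 - r))) = ennreal (A / (1 - r)\<^sup>2)"
    using r A by (simp add: ennreal_mult[symmetric] power2_eq_square)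
  finally have Z_int: "(\<integral>\<^sup>+\<omega>. Z \<omega> \<partial>M) \<le> ennreal (A / (1 - r)\<^sup>2)" .
  have path: "ennreal ((J w \<omega> - J 0 \<omega>)\<^sup>2) \<le> Z \<omega>" if cont: "continuous_on {0..1} (\<lambda>w. J w \<omega>)" and w: "w \<in> {0..1}" for \<omega> w
  proof -
    have partial: "ennreal (1 / (1 - r) * (\<Sum>m<n. S m \<omega> / r ^ m)) \<le> Z \<omega>" for n
    proof -
      have "ennreal (1 / (1 - r) * (\<Sum>m<n. S m \<omega> / r ^ m)) = ennreal (1 / (1 - r)) * (\<Sum>m<n. ennreal (S m \<omega> / r ^ m))"
        using r S_nonneg by (subst ennreal_mult) (auto intro!: sum_nonneg simp: sum_ennreal)
      also have "\<dots> \<le> Z \<omega>" unfolding Z_def by (intro mult_left_mono sum_le_suminf summableI) auto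
      finally show ?thesis .
    qed
    show ?thesis
    \<comment> \<open>At \<open>w = 1\<close> the floor would give the index \<open>2 ^ m\<close>,
      which belongs to no increment. This point is covered by the level 0 sum, the square of
      \<open>J 1 - J 0\<close>; all other points start from \<open>q 0 = 0\<close> and use levels
      from 1 on.\<close>
    proof (cases "w = 1")
      case True
      have "1 * (J w \<omega> - J 0 \<omega>)\<^sup>2 \<le> 1 / (1 - r) * (J w \<omega> - J 0 \<omega>)\<^sup>2"
        using r by (intro mult_right_mono) auto
      also have "\<dots> = 1 / (1 - r) * (\<Sum>m<1. S m \<omega> / r ^ m)"
        by (simp add: S_def \<Delta>_def True lessThan_Suc)
      finally show ?thesis using partial[of 1] by (auto intro: order_trans[OF ennreal_leI])
    next
      case False
      then have w: "0 \<le> w" "w < 1" using w by auto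
      define k where "k m = nat \<lfloor>w * 2 ^ m\<rfloor>" for m :: nat
      define q where "q m = real (k m) / 2 ^ m" for m
      have k: "real (k m) \<le> w * 2 ^ m" "w * 2 ^ m < real (k m) + 1" for m
        using w unfolding k_def by (auto simp: floor_le_iff)
      have k_lt: "k m < 2 ^ m" for m
      proof -
        have "w * 2 ^ m < 1 * 2 ^ m" using w by (intro mult_strict_right_mono) auto
        with k(1)[of m] have "real (k m) < 2 ^ m" by linarith
        then show ?thesis by simp
      qed
      have q0: "q 0 = 0" using k_lt[of 0] by (simp add: q_def)
      have q01: "q m \<in> {0..1}" for m unfolding q_def using k_lt[of m] by (intro grid) auto
      have step: "(J (q (Suc m)) \<omega> - J (q m) \<omega>)\<^sup>2 \<le> S (Suc m) \<omega>" for m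
      proof -
        \<comment> \<open>One more binary digit either leaves the approximation unchanged or adds
          exactly one increment of level \<open>Suc m\<close>.\<close>
        have "real (2 * k m) < real (k (Suc m)) + 1" "real (k (Suc m)) < real (2 * k m) + 2"
          using k[of m] k[of "Suc m"] by auto
        then have "k (Suc m) = 2 * k m \<or> k (Suc m) = Suc (2 * k m)" by linarith
        then show ?thesis
        proof
          assume "k (Suc m) = 2 * k m"
          then have "q (Suc m) = q m" by (simp add: q_def)
          then show ?thesis using S_nonneg by simp
        next
          assume *: "k (Suc m) = Suc (2 * k m)"
          have "q m = real (2 * k m) / 2 ^ Suc m" by (simp add: q_def)
          then have "(J (q (Suc m)) \<omega> - J (q m) \<omega>)\<^sup>2 = \<Delta> (Suc m) (2 * k m) \<omega>"
            unfolding \<Delta>_def * [symmetric] by (simp add: q_def)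
          also have "\<dots> \<le> S (Suc m) \<omega>"
            unfolding S_def using k_lt[of m] by (intro member_le_sum \<Delta>_nonneg) auto
          finally show ?thesis .
        qed
      qed
      have qn: "ennreal ((J (q n) \<omega> - J 0 \<omega>)\<^sup>2) \<le> Z \<omega>" for n
      proof -
        let ?d = "\<lambda>m. J (q (Suc m)) \<omega> - J (q m) \<omega>"
        \<comment> \<open>Cauchy-Schwarz weights whose squares are \<open>r ^ Suc m\<close>,
          matching the normalisation of the level sums in Z.\<close>
        let ?s = "\<lambda>m. sqrt r ^ Suc m"
        have s: "(?s m)\<^sup>2 = r ^ Suc m" for m
        proof -
          have "(?s m)\<^sup>2 = ((sqrt r)\<^sup>2) ^ Suc m" by (simp only: power_mult[symmetric] mult.commute)
          then show ?thesis using r by simp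
        qed
        have "J (q n) \<omega> - J 0 \<omega> = (\<Sum>m<n. ?d m)"
          using sum_lessThan_telescope[of "\<lambda>m. J (q m) \<omega>" n] by (simp add: q0)
        also have "\<dots> = (\<Sum>m<n. ?s m * (?d m / ?s m))" using r by simp
        finally have "(J (q n) \<omega> - J 0 \<omega>)\<^sup>2 = (\<Sum>m<n. ?s m * (?d m / ?s m))\<^sup>2" by simp
        also have "\<dots> \<le> (\<Sum>m<n. (?s m)\<^sup>2) * (\<Sum>m<n. (?d m / ?s m)\<^sup>2)"
          by (rule Cauchy_Schwarz_ineq_sum)
        also have "\<dots> \<le> (1 / (1 - r)) * (\<Sum>m<n. S (Suc m) \<omega> / r ^ Suc m)"
        proof (intro mult_mono)
          have "(\<Sum>m<n. (?s m)\<^sup>2) \<le> (\<Sum>m<n. r ^ m)"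
            unfolding s using r by (intro sum_mono) (auto intro: mult_left_le_one_le)
          also have "\<dots> \<le> (\<Sum>m. r ^ m)" using r by (intro sum_le_suminf summable_geometric) auto
          also have "\<dots> = 1 / (1 - r)" using r by (intro suminf_geometric) auto
          finally show "(\<Sum>m<n. (?s m)\<^sup>2) \<le> 1 / (1 - r)" .
          show "(\<Sum>m<n. (?d m / ?s m)\<^sup>2) \<le> (\<Sum>m<n. S (Suc m) \<omega> / r ^ Suc m)"
            unfolding power_divide s using r by (intro sum_mono divide_right_mono step) auto
        qed (use r in \<open>auto intro!: sum_nonneg\<close>)
        also have "\<dots> \<le> (1 / (1 - r)) * (\<Sum>m<Suc n. S m \<omega> / r ^ m)"
          using r S_nonneg unfolding sum.lessThan_Suc_shift by (intro mult_left_mono) auto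
        finally show ?thesis using partial[of "Suc n"] by (auto intro: order_trans[OF ennreal_leI])
      qed
      have "q \<longlonglongrightarrow> w"
      proof (rule tendsto_sandwich[of "\<lambda>n. w - 1 / 2 ^ n" _ _ "\<lambda>_. w"])
        have "(\<lambda>n. w - (1 / 2) ^ n) \<longlonglongrightarrow> w - 0"
          by (intro tendsto_diff tendsto_const LIMSEQ_realpow_zero) auto
        then show "(\<lambda>n. w - 1 / 2 ^ n) \<longlonglongrightarrow> w" by (simp add: power_divide)
        show "\<forall>\<^sub>F n in sequentially. w - 1 / 2 ^ n \<le> q n"
        proof (intro always_eventually allI)
          fix n
          have "w - 1 / 2 ^ n = (w * 2 ^ n - 1) / 2 ^ n" by (simp add: diff_divide_distrib)
          also have "\<dots> \<le> q n" unfolding q_def using k(2)[of n] by (intro divide_right_mono) auto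
          finally show "w - 1 / 2 ^ n \<le> q n" .
        qed
        show "\<forall>\<^sub>F n in sequentially. q n \<le> w"
          using k(1) by (intro always_eventually allI) (simp add: q_def field_simps)
      qed auto
      then have "(\<lambda>n. J (q n) \<omega>) \<longlonglongrightarrow> J w \<omega>"
        using w q01 by (intro continuous_on_tendsto_compose[OF cont]) auto
      then have "(\<lambda>n. ennreal ((J (q n) \<omega> - J 0 \<omega>)\<^sup>2)) \<longlonglongrightarrow> ennreal ((J w \<omega> - J 0 \<omega>)\<^sup>2)"
        by (intro tendsto_ennrealI tendsto_intros)
      then show ?thesis by (rule LIMSEQ_le_const2) (use qn in auto)
    qed
  qed
  show ?thesis
    using Z_meas Z_int path unfolding r_def by blast
qed

text \<open>In the clock W both \<open>t - s\<close> and \<open>V t - V s\<close> are at most linear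
  in the increment of W, so chaining applies to I run along the inverse of W. The bound at the left
  endpoint a then turns increments into values.\<close>

lemma block_maximal_bound:
  fixes I :: "real \<Rightarrow> 'a \<Rightarrow> real" and V :: "real \<Rightarrow> real"
  assumes \<alpha>: "0 < \<alpha>" "\<alpha> < 1" and D: "0 \<le> D"
    and ab: "0 < a" "a \<le> b" "b \<le> 2 * a"
    and V: "continuous_on {a..b} V" "mono_on {a..b} V" "0 < V a" "V b \<le> 2 * V a"
    and meas: "\<And>t. t \<in> {a..b} \<Longrightarrow> I t \<in> borel_measurable M"
    and incr: "\<And>s t. a \<le> s \<Longrightarrow> s \<le> t \<Longrightarrow> t \<le> b \<Longrightarrow>
      (\<integral>\<^sup>+\<omega>. ennreal ((I t \<omega> - I s \<omega>)\<^sup>2) \<partial>M) \<le> ennreal (D * (t - s) powr \<alpha> * (V t - V s))"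
    and init: "(\<integral>\<^sup>+\<omega>. ennreal ((I a \<omega>)\<^sup>2) \<partial>M) \<le> ennreal (D * a powr \<alpha> * V a)"
  shows "\<exists>Z. Z \<in> borel_measurable M \<and>
    (\<integral>\<^sup>+\<omega>. Z \<omega> \<partial>M) \<le> ennreal ((8 / (1 - 2 powr (- \<alpha> / 2))\<^sup>2 + 2) * D * a powr \<alpha> * V a) \<and>
    (\<forall>\<omega>. continuous_on {a..b} (\<lambda>t. I t \<omega>) \<longrightarrow> (\<forall>t\<in>{a..b}. ennreal ((I t \<omega>)\<^sup>2) \<le> Z \<omega>))"
proof -
  \<comment> \<open>Halving keeps W within \<open>{0..1}\<close>, as each summand is at most 1 on
    the block. The linear summand makes W strictly increasing even where V is flat, hence
    invertible.\<close>
  define W where "W t = ((t - a) / a + (V t - V a) / V a) / 2" for t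
  have V_mono: "V s \<le> V t" if "a \<le> s" "s \<le> t" "t \<le> b" for s t
    using V(2) that by (auto simp: mono_on_def)
  have W_diff: "t - s \<le> 2 * a * (W t - W s)" "V t - V s \<le> 2 * V a * (W t - W s)" if "a \<le> s" "s \<le> t" "t \<le> b" for s t
  proof -
    have *: "2 * (W t - W s) = (t - s) / a + (V t - V s) / V a"
      by (simp add: W_def diff_divide_distrib add_divide_distrib)
    have "a * (2 * (W t - W s)) = (t - s) + a * ((V t - V s) / V a)"
      using ab V(3) unfolding * by (simp add: distrib_left)
    moreover have "0 \<le> a * ((V t - V s) / V a)" using V_mono[OF that] V(3) ab by auto
    ultimately show "t - s \<le> 2 * a * (W t - W s)" by linarith
    have "V a * (2 * (W t - W s)) = V a * ((t - s) / a) + (V t - V s)"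
      using ab V(3) unfolding * by (simp add: distrib_left)
    moreover have "0 \<le> V a * ((t - s) / a)" using that V(3) ab by auto
    ultimately show "V t - V s \<le> 2 * V a * (W t - W s)" by linarith
  qed
  have W_less: "W s < W t" if "a \<le> s" "s < t" "t \<le> b" for s t
  proof -
    have "0 < 2 * a * (W t - W s)" using W_diff(1)[of s t] that by linarith
    then show ?thesis using ab by (simp add: zero_less_mult_iff)
  qed
  have inj: "inj_on W {a..b}"
  proof (rule inj_onI)
    fix s t assume "s \<in> {a..b}" "t \<in> {a..b}" "W s = W t"
    then show "s = t" using W_less[of s t] W_less[of t s] by (cases s t rule: linorder_cases) auto
  qed
  have W_cont: "continuous_on {a..b} W"
    unfolding W_def using ab V by (intro continuous_intros) auto
  define g where "g = inv_into {a..b} W"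
  define e where "e = W b"
  have Wa: "W a = 0" by (simp add: W_def)
  have e: "0 \<le> e" "e \<le> 1"
  proof -
    show "0 \<le> e" using W_less[of a b] ab Wa by (cases "a = b") (auto simp: e_def)
    have "(b - a) / a \<le> 1" "(V b - V a) / V a \<le> 1" using ab V by (auto simp: field_simps)
    then show "e \<le> 1" by (simp add: e_def W_def)
  qed
  have image: "{0..e} \<subseteq> W ` {a..b}"
  proof
    fix y assume "y \<in> {0..e}"
    then have "\<exists>x. a \<le> x \<and> x \<le> b \<and> W x = y" using ab W_cont Wa by (intro IVT') (auto simp: e_def)
    then show "y \<in> W ` {a..b}" by auto
  qed
  have g: "g y \<in> {a..b}" "W (g y) = y" if "y \<in> {0..e}" for y
    using that image inv_into_into[of y W "{a..b}"] f_inv_into_f[of y W "{a..b}"] unfolding g_def by auto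
  have gW: "g (W t) = t" if "t \<in> {a..b}" for t
    using that inj unfolding g_def by (simp add: inv_into_f_f)
  have g_cont: "continuous_on {0..e} g"
    using continuous_on_inv[OF W_cont, of g] gW image by (auto intro: continuous_on_subset)
  have g_mono: "g x \<le> g y" if "0 \<le> x" "x \<le> y" "y \<le> e" for x y
  proof (rule ccontr)
    assume "\<not> g x \<le> g y"
    then have "W (g y) < W (g x)" using g[of x] g[of y] that by (intro W_less) auto
    then show False using g(2)[of x] g(2)[of y] that by auto
  qed
  have ex: "0 \<le> e * x" "e * x \<le> e" if "0 \<le> x" "x \<le> 1" for x
    using that e by (auto simp: mult_left_le)
  \<comment> \<open>Scaling by \<open>e = W b \<le> 1\<close> moves the parameter to
    \<open>{0..1}\<close> without enlarging increments of W; \<open>e = 0\<close> is the one-point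
    block.\<close>
  let ?J = "\<lambda>x. I (g (e * x))"
  have "\<exists>Z. Z \<in> borel_measurable M \<and> (\<integral>\<^sup>+\<omega>. Z \<omega> \<partial>M) \<le> ennreal (4 * D * a powr \<alpha> * V a / (1 - 2 powr (- \<alpha> / 2))\<^sup>2) \<and>
    (\<forall>\<omega>. continuous_on {0..1} (\<lambda>w. ?J w \<omega>) \<longrightarrow> (\<forall>w\<in>{0..1}. ennreal ((?J w \<omega> - ?J 0 \<omega>)\<^sup>2) \<le> Z \<omega>))"
  proof (rule dyadic_chaining[OF \<alpha>(1)])
    fix v w :: real assume vw: "0 \<le> v" "v \<le> w" "w \<le> 1"
    let ?s = "g (e * v)" and ?t = "g (e * w)"
    have m: "e * v \<le> e * w" using vw e by (intro mult_left_mono) auto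
    have st: "a \<le> ?s" "?s \<le> ?t" "?t \<le> b"
      using g(1)[of "e * v"] g(1)[of "e * w"] ex[of v] ex[of w] vw g_mono[OF _ m] by auto
    have "W ?t - W ?s = e * (w - v)"
      using g(2)[of "e * v"] g(2)[of "e * w"] ex[of v] ex[of w] vw by (simp add: right_diff_distrib)
    also have "\<dots> \<le> w - v" using vw e by (intro mult_left_le_one_le) auto
    finally have W: "W ?t - W ?s \<le> w - v" .
    have "?t - ?s \<le> 2 * a * (w - v)"
      using W_diff(1)[OF st] mult_left_mono[OF W, of "2 * a"] ab by linarith
    then have "(?t - ?s) powr \<alpha> \<le> (2 * a * (w - v)) powr \<alpha>"
      using st \<alpha> by (intro powr_mono2) auto
    also have "\<dots> = 2 powr \<alpha> * (a powr \<alpha> * (w - v) powr \<alpha>)"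
      using ab vw by (simp add: powr_mult)
    also have "\<dots> \<le> 2 powr 1 * (a powr \<alpha> * (w - v) powr \<alpha>)"
      using \<alpha> by (intro mult_right_mono powr_mono) auto
    finally have 1: "(?t - ?s) powr \<alpha> \<le> 2 * (a powr \<alpha> * (w - v) powr \<alpha>)" by simp
    have 2: "V ?t - V ?s \<le> 2 * V a * (w - v)"
      using W_diff(2)[OF st] mult_left_mono[OF W, of "2 * V a"] V(3) by linarith
    have "(?t - ?s) powr \<alpha> * (V ?t - V ?s) \<le> (2 * (a powr \<alpha> * (w - v) powr \<alpha>)) * (2 * V a * (w - v))"
      using V_mono[OF st] by (intro mult_mono 1 2) auto
    also have "\<dots> = 4 * a powr \<alpha> * V a * (w - v) powr (1 + \<alpha>)"
      using vw by (simp add: powr_add)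
    finally have "D * ((?t - ?s) powr \<alpha> * (V ?t - V ?s)) \<le> D * (4 * a powr \<alpha> * V a * (w - v) powr (1 + \<alpha>))"
      using D by (rule mult_left_mono)
    then have "D * (?t - ?s) powr \<alpha> * (V ?t - V ?s) \<le> 4 * D * a powr \<alpha> * V a * (w - v) powr (1 + \<alpha>)"
      by (simp add: mult_ac)
    then show "(\<integral>\<^sup>+\<omega>. ennreal ((?J w \<omega> - ?J v \<omega>)\<^sup>2) \<partial>M) \<le> ennreal (4 * D * a powr \<alpha> * V a * (w - v) powr (1 + \<alpha>))"
      using order_trans[OF incr[OF st] ennreal_leI] by blast
  next
    show "?J w \<in> borel_measurable M" if "w \<in> {0..1}" for w
      using that ex[of w] by (intro meas g) auto
  qed (use D V ab in auto)
  then obtain Z where Z[measurable]: "Z \<in> borel_measurable M"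
    and Z_int: "(\<integral>\<^sup>+\<omega>. Z \<omega> \<partial>M) \<le> ennreal (4 * D * a powr \<alpha> * V a / (1 - 2 powr (- \<alpha> / 2))\<^sup>2)"
    and Z_path: "\<And>\<omega> w. continuous_on {0..1} (\<lambda>w. ?J w \<omega>) \<Longrightarrow> w \<in> {0..1} \<Longrightarrow> ennreal ((?J w \<omega> - ?J 0 \<omega>)\<^sup>2) \<le> Z \<omega>"
    by blast
  have g0: "g 0 = a" using gW[of a] Wa ab by simp
  have Ia[measurable]: "I a \<in> borel_measurable M" using ab by (intro meas) auto
  have "(\<integral>\<^sup>+\<omega>. 2 * Z \<omega> + 2 * ennreal ((I a \<omega>)\<^sup>2) \<partial>M) = 2 * (\<integral>\<^sup>+\<omega>. Z \<omega> \<partial>M) + 2 * (\<integral>\<^sup>+\<omega>. ennreal ((I a \<omega>)\<^sup>2) \<partial>M)"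
    by (simp add: nn_integral_add nn_integral_cmult)
  also have "\<dots> \<le> 2 * ennreal (4 * D * a powr \<alpha> * V a / (1 - 2 powr (- \<alpha> / 2))\<^sup>2) + 2 * ennreal (D * a powr \<alpha> * V a)"
    by (intro add_mono mult_left_mono Z_int init) auto
  also have "\<dots> = ennreal (2 * (4 * D * a powr \<alpha> * V a / (1 - 2 powr (- \<alpha> / 2))\<^sup>2)) + ennreal (2 * (D * a powr \<alpha> * V a))"
    by (simp only: ennreal_mult' ennreal_numeral zero_le_numeral)
  also have "\<dots> = ennreal (2 * (4 * D * a powr \<alpha> * V a / (1 - 2 powr (- \<alpha> / 2))\<^sup>2) + 2 * (D * a powr \<alpha> * V a))"
    using D V(3) by (intro ennreal_plus[symmetric]) auto
  \<comment> \<open>The 4 comes from \<open>2 powr \<alpha> \<le> 2\<close> and the factor 2 in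
    \<open>W_diff\<close>; splitting the square around \<open>I a\<close> doubles it to 8 and adds
    the 2.\<close>
  also have "2 * (4 * D * a powr \<alpha> * V a / (1 - 2 powr (- \<alpha> / 2))\<^sup>2) + 2 * (D * a powr \<alpha> * V a)
    = (8 / (1 - 2 powr (- \<alpha> / 2))\<^sup>2 + 2) * D * a powr \<alpha> * V a"
    by (simp add: distrib_right)
  finally have int: "(\<integral>\<^sup>+\<omega>. 2 * Z \<omega> + 2 * ennreal ((I a \<omega>)\<^sup>2) \<partial>M) \<le> ennreal ((8 / (1 - 2 powr (- \<alpha> / 2))\<^sup>2 + 2) * D * a powr \<alpha> * V a)" .
  have path: "ennreal ((I t \<omega>)\<^sup>2) \<le> 2 * Z \<omega> + 2 * ennreal ((I a \<omega>)\<^sup>2)"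
    if cont: "continuous_on {a..b} (\<lambda>t. I t \<omega>)" and t: "t \<in> {a..b}" for \<omega> t
  proof -
    have c: "continuous_on {0..1} (\<lambda>x. g (e * x))"
      using ex by (intro continuous_on_compose2[OF g_cont]) (auto intro!: continuous_intros)
    have cJ: "continuous_on {0..1} (\<lambda>w. ?J w \<omega>)"
      using ex g by (intro continuous_on_compose2[OF cont c]) auto
    have Wt: "0 \<le> W t" "W t \<le> e" using W_less[of a t] W_less[of t b] t Wa
      by (cases "t = a"; cases "t = b"; auto simp: e_def)+
    obtain w where w: "w \<in> {0..1}" "g (e * w) = t"
    proof (cases "e = 0")
      case True
      then have "t = a" using Wt Wa t inj ab by (auto simp: inj_on_def)
      then show ?thesis using that[of 0] g0 by simp
    next
      case False
      then have "g (e * (W t / e)) = t" using gW[OF t] by simp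
      then show ?thesis using that[of "W t / e"] Wt e False by auto
    qed
    have "(I t \<omega>)\<^sup>2 = ((?J w \<omega> - ?J 0 \<omega>) + I a \<omega>)\<^sup>2" by (simp add: w g0)
    also have "\<dots> \<le> 2 * (?J w \<omega> - ?J 0 \<omega>)\<^sup>2 + 2 * (I a \<omega>)\<^sup>2"
      using sum_squares_bound[of "?J w \<omega> - ?J 0 \<omega>" "I a \<omega>"] unfolding power2_sum by linarith
    finally have "ennreal ((I t \<omega>)\<^sup>2) \<le> ennreal (2 * (?J w \<omega> - ?J 0 \<omega>)\<^sup>2 + 2 * (I a \<omega>)\<^sup>2)" by (rule ennreal_leI)
    also have "\<dots> = 2 * ennreal ((?J w \<omega> - ?J 0 \<omega>)\<^sup>2) + 2 * ennreal ((I a \<omega>)\<^sup>2)"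
      by (simp add: ennreal_mult)
    also have "\<dots> \<le> 2 * Z \<omega> + 2 * ennreal ((I a \<omega>)\<^sup>2)"
      by (intro add_right_mono mult_left_mono Z_path cJ w) auto
    finally show ?thesis .
  qed
  show ?thesis
    using int path by (intro exI[of _ "\<lambda>\<omega>. 2 * Z \<omega> + 2 * ennreal ((I a \<omega>)\<^sup>2)"]) auto
qed

section \<open>Dyadic blocks and almost sure convergence\<close>

text \<open>The times in question form a compact set; its least and greatest elements belong to it,
  so the bounds on V hold at both ends of the block.\<close>

lemma continuous_mono_level_interval:
  fixes V :: "real \<Rightarrow> real"
  assumes V: "continuous_on {l..u} V" "mono_on {l..u} V" and ne: "\<exists>t\<in>{l..u}. V t \<in> {x..y}"
  obtains a b where "a \<le> b" "l \<le> a" "b \<le> u" "x \<le> V a" "V b \<le> y"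
    "\<And>t. t \<in> {l..u} \<Longrightarrow> V t \<in> {x..y} \<Longrightarrow> t \<in> {a..b}"
proof -
  define S where "S = {l..u} \<inter> V -` {x..y}"
  have "compact S"
    unfolding S_def compact_eq_bounded_closed
    using continuous_closed_preimage[OF V(1), of "{x..y}"] bounded_closed_interval[of l u]
    by (auto intro: bounded_subset)
  moreover have "S \<noteq> {}" using ne by (auto simp: S_def)
  ultimately obtain a b where "a \<in> S" "\<forall>t\<in>S. a \<le> t" "b \<in> S" "\<forall>t\<in>S. t \<le> b"
    using compact_attains_inf[of S] compact_attains_sup[of S] by blast
  then show ?thesis by (intro that[of a b]) (auto simp: S_def)
qed

text \<open>A double sum with finite mean is almost surely finite, so its rows tend to 0. Whole rows
  are kept because the level j met at a given time is not controlled.\<close>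

lemma AE_tendsto_zero_of_dyadic_blocks:
  fixes Z :: "nat \<Rightarrow> nat \<Rightarrow> 'a \<Rightarrow> ennreal"
  assumes [measurable]: "\<And>i j. Z i j \<in> borel_measurable M"
    and bound: "\<And>i j. (\<integral>\<^sup>+\<omega>. Z i j \<omega> \<partial>M) \<le> ennreal (K * x ^ j * y ^ i)"
    and K: "0 \<le> K" "0 < x" "x < 1" "0 < y" "y < 1"
  shows "AE \<omega> in M. (\<lambda>i. \<Sum>j. Z i j \<omega>) \<longlonglongrightarrow> 0"
proof -
  have "(\<integral>\<^sup>+\<omega>. (\<Sum>i. \<Sum>j. Z i j \<omega>) \<partial>M) = (\<Sum>i. \<Sum>j. \<integral>\<^sup>+\<omega>. Z i j \<omega> \<partial>M)"
    by (simp add: nn_integral_suminf)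
  also have "\<dots> \<le> (\<Sum>i. \<Sum>j. ennreal (K * x ^ j * y ^ i))"
    by (intro suminf_le summableI bound)
  also have "\<dots> = (\<Sum>i. ennreal (K * (1 / (1 - x)) * y ^ i))"
    using K by (intro suminf_cong suminf_ennreal_eq sums_mult2 sums_mult geometric_sums) auto
  also have "\<dots> = ennreal (K * (1 / (1 - x)) * (1 / (1 - y)))"
    using K by (intro suminf_ennreal_eq sums_mult geometric_sums) auto
  finally have "(\<integral>\<^sup>+\<omega>. (\<Sum>i. \<Sum>j. Z i j \<omega>) \<partial>M) \<noteq> \<infinity>" by (auto simp: top_unique)
  then have "AE \<omega> in M. (\<Sum>i. \<Sum>j. Z i j \<omega>) \<noteq> \<infinity>"
    by (rule nn_integral_noteq_infinite[rotated]) measurable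
  then show ?thesis
  proof eventually_elim
    case (elim \<omega>)
    let ?w = "\<lambda>i. \<Sum>j. Z i j \<omega>"
    have "?w i \<noteq> \<infinity>" for i
    proof -
      have "?w i = (\<Sum>k\<in>{i}. ?w k)" by simp
      also have "\<dots> \<le> (\<Sum>k. ?w k)" by (intro sum_le_suminf summableI) auto
      finally show ?thesis using elim by (auto simp: top_unique)
    qed
    then have w: "?w = (\<lambda>i. ennreal (enn2real (?w i)))" by (auto simp: fun_eq_iff less_top)
    have "summable (\<lambda>i. enn2real (?w i))"
    proof (rule summable_suminf_not_top)
      show "(\<Sum>i. ennreal (enn2real (?w i))) \<noteq> \<top>" using elim w by simp
    qed simp
    then have "(\<lambda>i. enn2real (?w i)) \<longlonglongrightarrow> 0" by (rule summable_LIMSEQ_zero)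
    from tendsto_ennrealI[OF this] show ?case using w by simp
  qed
qed

text \<open>Every late time lies in some block \<open>(i, j)\<close>, where the squared ratio is at
  most the block variable divided by \<open>(2 ^ j)\<^sup>2\<close>; the row sum over j dominates it
  whatever j is.\<close>

lemma AE_ratio_tendsto_zero:
  fixes I :: "real \<Rightarrow> 'a \<Rightarrow> real" and V :: "real \<Rightarrow> real"
  assumes \<alpha>: "0 < \<alpha>" "\<alpha> < 1" and p: "0 < p" and c: "0 < c" and D: "0 \<le> D"
    and V: "continuous_on {0<..} V" "mono_on {0<..} V"
    and growth: "\<forall>\<^sub>F t in at_top. c * t powr (\<alpha> + p) \<le> V t"
    and meas: "\<And>t. 0 < t \<Longrightarrow> I t \<in> borel_measurable M"
    and incr: "\<And>s t. 0 < s \<Longrightarrow> s \<le> t \<Longrightarrow>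
      (\<integral>\<^sup>+\<omega>. ennreal ((I t \<omega> - I s \<omega>)\<^sup>2) \<partial>M) \<le> ennreal (D * (t - s) powr \<alpha> * (V t - V s))"
    and init: "\<And>t. 0 < t \<Longrightarrow> (\<integral>\<^sup>+\<omega>. ennreal ((I t \<omega>)\<^sup>2) \<partial>M) \<le> ennreal (D * t powr \<alpha> * V t)"
    and cont: "AE \<omega> in M. continuous_on {0<..} (\<lambda>t. I t \<omega>)"
  shows "AE \<omega> in M. ((\<lambda>t. I t \<omega> / V t) \<longlongrightarrow> 0) at_top"
proof -
  have "\<forall>\<^sub>F t in at_top. 1 \<le> c * t powr (\<alpha> + p)"
    using eventually_ge_at_top[of "(1 / c) powr (1 / (\<alpha> + p))"]
  proof eventually_elim
    case (elim t)
    have "1 = c * ((1 / c) powr (1 / (\<alpha> + p))) powr (\<alpha> + p)" using c \<alpha> p by (simp add: powr_powr)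
    also have "\<dots> \<le> c * t powr (\<alpha> + p)" using elim c \<alpha> p by (intro mult_left_mono powr_mono2) auto
    finally show ?case .
  qed
  with growth have "\<forall>\<^sub>F t in at_top. c * t powr (\<alpha> + p) \<le> V t \<and> 1 \<le> V t"
    by eventually_elim auto
  then obtain t0 where t0: "\<And>t. t0 \<le> t \<Longrightarrow> c * t powr (\<alpha> + p) \<le> V t \<and> 1 \<le> V t"
    by (auto simp: eventually_at_top_linorder)
  \<comment> \<open>Growth holds only eventually. From \<open>2 ^ i0\<close> on, V is at least 1, so
    it always falls into a level with \<open>j \<ge> 0\<close>.\<close>
  obtain i0 where i0: "t0 < 2 ^ i0" using real_arch_pow[of 2 t0] by auto
  have large: "c * t powr (\<alpha> + p) \<le> V t" "1 \<le> V t" if "i0 \<le> i" "2 ^ i \<le> t" for i t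
  proof -
    have "t0 \<le> t" using i0 that power_increasing[OF that(1), of "2::real"] by linarith
    then show "c * t powr (\<alpha> + p) \<le> V t" "1 \<le> V t" using t0 by auto
  qed
  \<comment> \<open>A block met by the graph of \<open>V\<close> has \<open>2 powr - j \<le> (2 / c) * 2 powr (- i * (\<alpha> + p))\<close>; spending only the
    power \<open>1 - \<delta>\<close> of this estimate leaves a factor that is still summable in \<open>j\<close>.\<close>
  define \<delta> where "\<delta> = p / (2 * (\<alpha> + p))"
  have \<delta>: "0 < \<delta>" "\<delta> < 1" "(\<alpha> + p) * (1 - \<delta>) = \<alpha> + p / 2"
    using \<alpha> p by (auto simp: \<delta>_def field_simps)
  define C where "C = 8 / (1 - 2 powr (- \<alpha> / 2))\<^sup>2 + 2"
  have C: "0 \<le> C" by (simp add: C_def)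
  \<comment> \<open>\<open>C * D\<close> is the block bound. The 4 collects
    \<open>a powr \<alpha> \<le> 2 * (2 ^ i) powr \<alpha>\<close> and
    \<open>V a / (2 ^ j)\<^sup>2 \<le> 2 / 2 ^ j\<close>; the last factor is the constant of the
    growth estimate raised to \<open>1 - \<delta>\<close>.\<close>
  define K where "K = C * D * 4 * (2 / c) powr (1 - \<delta>)"
  define x y :: real where "x = 2 powr - \<delta>" and "y = 2 powr - (p / 2)"
  have xy: "0 < x" "x < 1" "0 < y" "y < 1"
    using \<delta> p by (auto simp: x_def y_def powr_less_one)
  have K: "0 \<le> K" using C D by (simp add: K_def)
  define P where "P i j Z \<longleftrightarrow> Z \<in> borel_measurable M \<and> (\<integral>\<^sup>+\<omega>. Z \<omega> \<partial>M) \<le> ennreal (K * x ^ j * y ^ i) \<and>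
     (i0 \<le> i \<longrightarrow> (\<forall>\<omega>. continuous_on {0<..} (\<lambda>t. I t \<omega>) \<longrightarrow>
        (\<forall>t\<in>{2 ^ i..2 ^ Suc i}. V t \<in> {2 ^ j..2 ^ Suc j} \<longrightarrow> ennreal ((I t \<omega> / V t)\<^sup>2) \<le> Z \<omega>)))" for i j Z
  have ex: "\<exists>Z. P i j Z" for i j
  proof (cases "i0 \<le> i \<and> (\<exists>t\<in>{2 ^ i..2 ^ Suc i}. V t \<in> {2 ^ j..2 ^ Suc j})")
    \<comment> \<open>Early blocks and blocks the graph of V misses have nothing to dominate, so
      zero serves.\<close>
    case False
    then show ?thesis unfolding P_def by (intro exI[of _ "\<lambda>_. 0"]) auto
  next
    case True
    have sub: "{2 ^ i..2 ^ Suc i} \<subseteq> {0::real<..}" by (auto intro: less_le_trans[of _ "2 ^ i"])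
    have "continuous_on {2 ^ i..2 ^ Suc i} V" "mono_on {2 ^ i..2 ^ Suc i} V"
      using V sub by (blast intro: continuous_on_subset mono_on_subset)+
    from continuous_mono_level_interval[OF this conjunct2[OF True]]
    obtain a b where ab: "a \<le> b" "2 ^ i \<le> a" "b \<le> 2 ^ Suc i" "2 ^ j \<le> V a" "V b \<le> 2 ^ Suc j"
      and cover: "\<And>t. t \<in> {2 ^ i..2 ^ Suc i} \<Longrightarrow> V t \<in> {2 ^ j..2 ^ Suc j} \<Longrightarrow> t \<in> {a..b}"
      by metis
    have a: "0 < a" using ab(2) by (rule less_le_trans[rotated]) simp
    have sub': "{a..b} \<subseteq> {0<..}" using a by auto
    have Va: "0 < V a" using ab(4) by (rule less_le_trans[rotated]) simp
    have Vab: "V a \<le> V b" using V(2) ab(1) a by (auto simp: mono_on_def)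
    have "\<exists>Z. Z \<in> borel_measurable M \<and> (\<integral>\<^sup>+\<omega>. Z \<omega> \<partial>M) \<le> ennreal (C * D * a powr \<alpha> * V a) \<and>
      (\<forall>\<omega>. continuous_on {a..b} (\<lambda>t. I t \<omega>) \<longrightarrow> (\<forall>t\<in>{a..b}. ennreal ((I t \<omega>)\<^sup>2) \<le> Z \<omega>))"
      unfolding C_def
      using a ab Va V sub' by (intro block_maximal_bound[OF \<alpha> D] meas incr init)
        (auto intro: continuous_on_subset mono_on_subset)
    then obtain Z where Z[measurable]: "Z \<in> borel_measurable M"
      and Z_int: "(\<integral>\<^sup>+\<omega>. Z \<omega> \<partial>M) \<le> ennreal (C * D * a powr \<alpha> * V a)"
      and Z_path: "\<And>\<omega> t. continuous_on {a..b} (\<lambda>t. I t \<omega>) \<Longrightarrow> t \<in> {a..b} \<Longrightarrow> ennreal ((I t \<omega>)\<^sup>2) \<le> Z \<omega>"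
      by blast
    let ?Z = "\<lambda>\<omega>. ennreal (1 / (2 ^ j)\<^sup>2) * Z \<omega>"
    have "(\<integral>\<^sup>+\<omega>. ?Z \<omega> \<partial>M) = ennreal (1 / (2 ^ j)\<^sup>2) * (\<integral>\<^sup>+\<omega>. Z \<omega> \<partial>M)"
      by (rule nn_integral_cmult) measurable
    also have "\<dots> \<le> ennreal (1 / (2 ^ j)\<^sup>2) * ennreal (C * D * a powr \<alpha> * V a)"
      by (intro mult_left_mono Z_int) auto
    also have "\<dots> = ennreal (1 / (2 ^ j)\<^sup>2 * (C * D * a powr \<alpha> * V a))"
      using C D Va by (intro ennreal_mult[symmetric]) auto
    also have "\<dots> \<le> ennreal (K * x ^ j * y ^ i)"
    proof (rule ennreal_leI)
      let ?X = "2 powr real i :: real" and ?Y = "2 powr - real j :: real"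
      have X: "(2::real) ^ i = ?X" by (simp add: powr_realpow)
      have Y: "1 / (2::real) ^ j = ?Y" by (simp add: powr_minus powr_realpow divide_inverse)
      have "a \<le> 2 * ?X" using ab X by simp
      then have "a powr \<alpha> \<le> (2 * ?X) powr \<alpha>" using a \<alpha> by (intro powr_mono2) auto
      also have "\<dots> = 2 powr \<alpha> * ?X powr \<alpha>" by (simp add: powr_mult)
      also have "\<dots> \<le> 2 powr 1 * ?X powr \<alpha>" using \<alpha> by (intro mult_right_mono powr_mono) auto
      finally have 1: "a powr \<alpha> \<le> 2 * ?X powr \<alpha>" by simp
      have 2: "V a / (2 ^ j)\<^sup>2 \<le> 2 * ?Y"
      proof -
        have "V a / (2 ^ j)\<^sup>2 \<le> (2 * 2 ^ j) / (2 ^ j)\<^sup>2" using Vab ab by (intro divide_right_mono) auto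
        also have "\<dots> = 2 * (1 / 2 ^ j)" by (simp add: power2_eq_square)
        finally show ?thesis unfolding Y .
      qed
      have 3: "?Y \<le> 2 / c * ?X powr - (\<alpha> + p)"
      proof -
        have "c * ?X powr (\<alpha> + p) \<le> c * a powr (\<alpha> + p)"
          using ab(2) X c \<alpha> p by (intro mult_left_mono powr_mono2) auto
        also have "\<dots> \<le> V a" using large(1)[of i a] True ab by auto
        also have "\<dots> \<le> 2 * 2 ^ j" using Vab ab by simp
        finally have "c * ?X powr (\<alpha> + p) \<le> 2 / ?Y" unfolding Y[symmetric] by simp
        then have "?Y * (c * ?X powr (\<alpha> + p)) \<le> 2" by (simp add: field_simps)
        moreover have "?X powr - (\<alpha> + p) = 1 / ?X powr (\<alpha> + p)" by (rule powr_minus_divide)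
        ultimately show ?thesis using c by (simp only:) (simp add: field_simps)
      qed
      have "?Y = ?Y powr \<delta> * ?Y powr (1 - \<delta>)" by (simp add: powr_add[symmetric])
      also have "\<dots> \<le> ?Y powr \<delta> * (2 / c * ?X powr - (\<alpha> + p)) powr (1 - \<delta>)"
        using \<delta> by (intro mult_left_mono powr_mono2 3) auto
      also have "(2 / c * ?X powr - (\<alpha> + p)) powr (1 - \<delta>) = (2 / c) powr (1 - \<delta>) * ?X powr (- (\<alpha> + p / 2))"
      proof -
        have "(2 / c * ?X powr - (\<alpha> + p)) powr (1 - \<delta>) = (2 / c) powr (1 - \<delta>) * (?X powr - (\<alpha> + p)) powr (1 - \<delta>)"
          by (rule powr_mult)
        also have "(?X powr - (\<alpha> + p)) powr (1 - \<delta>) = ?X powr (- (\<alpha> + p / 2))"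
          unfolding \<delta>(3)[symmetric] powr_powr by (simp only: mult_minus_left mult_minus_right mult.assoc)
        finally show ?thesis .
      qed
      finally have 4: "?Y \<le> ?Y powr \<delta> * ((2 / c) powr (1 - \<delta>) * ?X powr (- (\<alpha> + p / 2)))" .
      have "1 / (2 ^ j)\<^sup>2 * (C * D * a powr \<alpha> * V a) = C * D * (a powr \<alpha> * (V a / (2 ^ j)\<^sup>2))" by simp
      also have "\<dots> \<le> C * D * ((2 * ?X powr \<alpha>) * (2 * ?Y))"
        using C D Va by (intro mult_left_mono mult_mono 1 2) auto
      also have "\<dots> \<le> C * D * ((2 * ?X powr \<alpha>) * (2 * (?Y powr \<delta> * ((2 / c) powr (1 - \<delta>) * ?X powr (- (\<alpha> + p / 2))))))"
        using C D by (intro mult_left_mono 4) auto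
      also have "\<dots> = K * ?Y powr \<delta> * (?X powr \<alpha> * ?X powr (- (\<alpha> + p / 2)))"
        by (simp add: K_def)
      also have "?X powr \<alpha> * ?X powr (- (\<alpha> + p / 2)) = ?X powr - (p / 2)"
        by (simp add: powr_add[symmetric])
      also have "\<dots> = y ^ i"
        using xy by (simp add: y_def powr_powr mult.commute flip: powr_realpow)
      also have "?Y powr \<delta> = x ^ j"
        using xy by (simp add: x_def powr_powr mult.commute flip: powr_realpow)
      finally show "1 / (2 ^ j)\<^sup>2 * (C * D * a powr \<alpha> * V a) \<le> K * x ^ j * y ^ i" .
    qed
    finally have int: "(\<integral>\<^sup>+\<omega>. ?Z \<omega> \<partial>M) \<le> ennreal (K * x ^ j * y ^ i)" .
    have path: "ennreal ((I t \<omega> / V t)\<^sup>2) \<le> ?Z \<omega>"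
      if "continuous_on {0<..} (\<lambda>t. I t \<omega>)" "t \<in> {2 ^ i..2 ^ Suc i}" "V t \<in> {2 ^ j..2 ^ Suc j}" for \<omega> t
    proof -
      have "(I t \<omega> / V t)\<^sup>2 = 1 / (V t)\<^sup>2 * (I t \<omega>)\<^sup>2" by (simp add: power_divide)
      also have "\<dots> \<le> 1 / (2 ^ j)\<^sup>2 * (I t \<omega>)\<^sup>2"
        using that(3) by (intro mult_right_mono divide_left_mono power_mono mult_pos_pos zero_less_power)
          (auto intro: less_le_trans[of 0 "2 ^ j"])
      finally have "ennreal ((I t \<omega> / V t)\<^sup>2) \<le> ennreal (1 / (2 ^ j)\<^sup>2) * ennreal ((I t \<omega>)\<^sup>2)"
        by (simp add: ennreal_mult[symmetric] ennreal_leI)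
      also have "\<dots> \<le> ?Z \<omega>"
        using cover[OF that(2,3)] continuous_on_subset[OF that(1) sub'] by (intro mult_left_mono Z_path) auto
      finally show ?thesis .
    qed
    show ?thesis unfolding P_def using int path by (intro exI[of _ ?Z]) auto
  qed
  define Z where "Z i j = (SOME Z. P i j Z)" for i j
  have Z: "P i j (Z i j)" for i j
    unfolding Z_def by (rule someI_ex[OF ex])
  have Z_meas: "Z i j \<in> borel_measurable M"
    and Z_int: "(\<integral>\<^sup>+\<omega>. Z i j \<omega> \<partial>M) \<le> ennreal (K * x ^ j * y ^ i)"
    and Z_path: "i0 \<le> i \<Longrightarrow> continuous_on {0<..} (\<lambda>t. I t \<omega>) \<Longrightarrow> t \<in> {2 ^ i..2 ^ Suc i} \<Longrightarrow>
        V t \<in> {2 ^ j..2 ^ Suc j} \<Longrightarrow> ennreal ((I t \<omega> / V t)\<^sup>2) \<le> Z i j \<omega>" for i j \<omega> t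
    using Z[of i j] unfolding P_def by blast+
  have dyadic: "\<exists>n. z \<in> {2 ^ n..2 ^ Suc n}" if "1 \<le> z" for z :: real
  proof -
    define n where "n = nat \<lfloor>log 2 z\<rfloor>"
    have "0 \<le> log 2 z" using that by simp
    then have n: "real n \<le> log 2 z" "log 2 z \<le> real (Suc n)" unfolding n_def by (auto, linarith)
    have "2 powr real n \<le> 2 powr log 2 z" "2 powr log 2 z \<le> 2 powr real (Suc n)"
      by (intro powr_mono n; simp)+
    then show ?thesis using that by (intro exI[of _ n]) (simp add: powr_realpow del: of_nat_Suc)
  qed
  from AE_tendsto_zero_of_dyadic_blocks[OF Z_meas Z_int K xy] cont
  show ?thesis
  proof eventually_elim
    case (elim \<omega>)
    show ?case
    proof (rule tendstoI)
      fix \<epsilon> :: real assume "0 < \<epsilon>"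
      then have "0 < ennreal (\<epsilon>\<^sup>2)" by simp
      from order_tendstoD(2)[OF elim(1) this] obtain i1
        where i1: "\<And>i. i1 \<le> i \<Longrightarrow> (\<Sum>j. Z i j \<omega>) < ennreal (\<epsilon>\<^sup>2)"
        by (auto simp: eventually_sequentially)
      show "\<forall>\<^sub>F t in at_top. dist (I t \<omega> / V t) 0 < \<epsilon>"
        using eventually_gt_at_top[of "2 ^ max i0 i1"]
      proof eventually_elim
        case t: (elim t)
        have "1 \<le> t" using t one_le_power[of "2::real" "max i0 i1"] by linarith
        with dyadic obtain i where i: "t \<in> {2 ^ i..2 ^ Suc i}" by blast
        \<comment> \<open>The strict lower bound on t matters: blocks are closed, and
          \<open>2 ^ max i0 i1\<close> itself could be assigned to the preceding one.\<close>
        have "(2::real) ^ max i0 i1 < 2 ^ Suc i" using t i by auto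
        then have "max i0 i1 < Suc i" by (rule power_less_imp_less_exp[rotated]) simp
        then have ii: "i0 \<le> i" "i1 \<le> i" by auto
        with large(2)[of i t] i dyadic obtain j where j: "V t \<in> {2 ^ j..2 ^ Suc j}" by auto
        have "ennreal ((I t \<omega> / V t)\<^sup>2) \<le> Z i j \<omega>" by (rule Z_path[OF ii(1) elim(2) i j])
        also have "\<dots> = (\<Sum>k\<in>{j}. Z i k \<omega>)" by simp
        also have "\<dots> \<le> (\<Sum>k. Z i k \<omega>)" by (intro sum_le_suminf summableI) auto
        also have "\<dots> < ennreal (\<epsilon>\<^sup>2)" by (rule i1[OF ii(2)])
        finally have "(I t \<omega> / V t)\<^sup>2 < \<epsilon>\<^sup>2" by (simp only: ennreal_less_iff zero_le_power2)
        then have "\<bar>I t \<omega> / V t\<bar>\<^sup>2 < \<epsilon>\<^sup>2" by (simp only: power2_abs)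
        then have "\<bar>I t \<omega> / V t\<bar> < \<epsilon>" by (rule power2_less_imp_less) (use \<open>0 < \<epsilon>\<close> in simp)
        then show ?case by (simp only: dist_real_def diff_zero)
      qed
    qed
  qed
qed

section \<open>Strong consistency\<close>

lemma square_integral_function:
  fixes \<phi> :: "real \<Rightarrow> real"
  defines "V \<equiv> \<lambda>t. LINT s:{0..t}|lborel. (\<phi> s)\<^sup>2"
  assumes int: "\<And>t. set_integrable lborel {0..t} (\<lambda>s. (\<phi> s)\<^sup>2)"
  shows "continuous_on {0<..} V" "mono_on {0..} V"
    and "\<And>s t. 0 \<le> s \<Longrightarrow> s \<le> t \<Longrightarrow>
      (\<integral>\<^sup>+x. ennreal ((indicator {s<..t} x * \<phi> x)\<^sup>2) \<partial>lborel) = ennreal (V t - V s)"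
proof -
  have sub: "set_integrable lborel A (\<lambda>s. (\<phi> s)\<^sup>2)" if "A \<in> sets borel" "A \<subseteq> {0..t}" for A t
    using set_integrable_subset[OF int] that by simp
  have V_diff: "V t - V s = (LINT x:{s<..t}|lborel. (\<phi> x)\<^sup>2)" if "0 \<le> s" "s \<le> t" for s t
  proof -
    have "{0..t} = {0..s} \<union> {s<..t}" using that by auto
    moreover have "set_integrable lborel {s<..t} (\<lambda>s. (\<phi> s)\<^sup>2)"
      by (rule sub[where t = t]) (use that in auto)
    moreover have "{0..s} \<inter> {s<..t} = {}" by auto
    ultimately have "V t = V s + (LINT x:{s<..t}|lborel. (\<phi> x)\<^sup>2)"
      unfolding V_def by (metis int set_integral_Un)
    then show ?thesis by simp
  qed
  show nn: "(\<integral>\<^sup>+x. ennreal ((indicator {s<..t} x * \<phi> x)\<^sup>2) \<partial>lborel) = ennreal (V t - V s)"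
    if "0 \<le> s" "s \<le> t" for s t
  proof -
    have "set_integrable lborel {s<..t} (\<lambda>s. (\<phi> s)\<^sup>2)"
      by (rule sub[where t = t]) (use that in auto)
    then have "integrable lborel (\<lambda>x. indicator {s<..t} x * (\<phi> x)\<^sup>2)" by (simp add: set_integrable_def)
    from nn_integral_eq_integral[OF this]
    have "(\<integral>\<^sup>+x. ennreal (indicator {s<..t} x * (\<phi> x)\<^sup>2) \<partial>lborel) = ennreal (V t - V s)"
      by (simp add: V_diff[OF that] set_lebesgue_integral_def)
    moreover have "(indicator {s<..t} x * \<phi> x)\<^sup>2 = indicator {s<..t} x * (\<phi> x)\<^sup>2" for x
      by (simp add: indicator_def)
    ultimately show ?thesis by simp
  qed
  show "mono_on {0..} V"
  proof (rule mono_onI)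
    fix s t :: real assume "s \<in> {0..}" "t \<in> {0..}" "s \<le> t"
    then have "V t - V s = (LINT x:{s<..t}|lborel. (\<phi> x)\<^sup>2)" by (intro V_diff) auto
    also have "0 \<le> \<dots>" unfolding set_lebesgue_integral_def by (intro integral_nonneg_AE) auto
    finally show "V s \<le> V t" by simp
  qed
  \<comment> \<open>Continuity is taken over from the indefinite gauge integral.\<close>
  have V_eq: "V t = integral {0..t} (\<lambda>s. (\<phi> s)\<^sup>2)" for t
    unfolding V_def by (rule set_borel_integral_eq_integral(2)[OF int])
  have "isCont V t" if "0 < t" for t
  proof -
    have "continuous_on {0..t + 1} V"
      unfolding V_eq by (rule indefinite_integral_continuous_1) (rule set_borel_integral_eq_integral(1)[OF int])
    then show ?thesis using that by (intro continuous_on_interior) auto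
  qed
  then show "continuous_on {0<..} V" by (simp add: continuous_on_eq_continuous_at)
qed

theorem theorem4p2:
  fixes M :: "'a measure" and H \<theta> x0 :: real
    and B X :: "real \<Rightarrow> 'a \<Rightarrow> real"
    and a b :: "real \<Rightarrow> real \<Rightarrow> real" and \<phi> :: "real \<Rightarrow> real"
  assumes H: "1/2 < H" "H < 1"
    and fbm: "is_fbm M H B"
    and X_meas: "\<forall>t. X t \<in> borel_measurable M"
    and X_sol: "AE \<omega> in M. \<forall>t\<ge>0.
           rs_has_integral (\<lambda>s. b s (X s \<omega>)) (\<lambda>s. B s \<omega>) 0 t
             (X t \<omega> - x0 - \<theta> * (LINT s:{0..t}|lborel. a s (X s \<omega>)))"
    and A1: "\<forall>T. \<exists>K. \<forall>s\<in>{0..T}. \<forall>x. \<bar>a s x\<bar> + \<bar>b s x\<bar> \<le> K * (1 + \<bar>x\<bar>)"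
    and A2': "\<forall>T. \<exists>K. \<forall>t\<in>{0..T}. \<forall>x y.
                \<bar>a t x - a t y\<bar> + \<bar>b t x - b t y\<bar> \<le> K * \<bar>x - y\<bar>"
    and A3: "(\<forall>t x. (\<lambda>y. b t y) differentiable (at x)) \<and>
             (\<exists>\<beta>. 1 - H < \<beta> \<and> \<beta> < 1 \<and> (\<forall>T. \<exists>K. \<forall>s\<in>{0..T}. \<forall>t\<in>{0..T}. \<forall>x.
                \<bar>a s x - a t x\<bar> + \<bar>b s x - b t x\<bar>
                + \<bar>deriv (\<lambda>y. b s y) x - deriv (\<lambda>y. b t y) x\<bar> \<le> K * \<bar>s - t\<bar> powr \<beta>))"
    and A4': "\<exists>\<rho>. 3/2 - H < \<rho> \<and> \<rho> < 1 \<and> (\<forall>T. \<exists>D. \<forall>t\<in>{0..T}. \<forall>x y.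
                \<bar>deriv (\<lambda>z. b t z) x - deriv (\<lambda>z. b t z) y\<bar> \<le> D * \<bar>x - y\<bar> powr \<rho>)"
    and B1: "AE \<omega> in M. \<forall>t\<ge>0. b t (X t \<omega>) \<noteq> 0"
    and B1_int: "\<forall>T. set_integrable lborel {0..T} \<phi>"
    and phi_def: "AE \<omega> in M. \<forall>t\<ge>0. \<phi> t = a t (X t \<omega>) / b t (X t \<omega>)"
    and B2: "(\<forall>t>0. J_fun H \<phi> differentiable (at t)) \<and>
             (\<forall>T. set_integrable lborel {0<..T}
                    (\<lambda>s. (chi_fun H \<phi> s)\<^sup>2 * (2 - 2*H) * s powr (1 - 2*H)))"
    and B5: "\<exists>p>0. \<exists>C. \<forall>\<^sub>F T in at_top.
               0 < (LINT t:{0..T}|lborel. (\<phi> t)\<^sup>2) \<and>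
               T powr (2*H - 1 + p) \<le> C * (LINT t:{0..T}|lborel. (\<phi> t)\<^sup>2)"
  shows "\<forall>I :: real \<Rightarrow> 'a \<Rightarrow> real.
           (\<forall>T>0. wiener_integral_fbm M H B \<phi> T (I T)) \<and>
           (AE \<omega> in M. continuous_on {0<..} (\<lambda>T. I T \<omega>)) \<longrightarrow>
           (AE \<omega> in M. ((\<lambda>T. \<theta> + I T \<omega> / (LINT s:{0..T}|lborel. (\<phi> s)\<^sup>2)) \<longlongrightarrow> \<theta>) at_top)"
proof (intro allI impI, elim conjE)
  fix I :: "real \<Rightarrow> 'a \<Rightarrow> real"
  assume I: "\<forall>T>0. wiener_integral_fbm M H B \<phi> T (I T)"
    and cont: "AE \<omega> in M. continuous_on {0<..} (\<lambda>T. I T \<omega>)"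
  define V where "V t = (LINT s:{0..t}|lborel. (\<phi> s)\<^sup>2)" for t
  obtain p C where p: "0 < p"
    and C: "\<forall>\<^sub>F T in at_top. 0 < V T \<and> T powr (2 * H - 1 + p) \<le> C * V T"
    using B5 unfolding V_def by blast
  have "\<forall>\<^sub>F T in at_top. 0 < T \<and> 0 < V T \<and> T powr (2 * H - 1 + p) \<le> C * V T"
    using C eventually_gt_at_top[of 0] by eventually_elim auto
  from eventually_happens'[OF trivial_limit_at_top_linorder this]
  obtain T where T: "0 < T" "0 < V T" "T powr (2 * H - 1 + p) \<le> C * V T"
    by blast
  have "0 < T powr (2 * H - 1 + p)" using T(1) by simp
  also note T(3)
  finally have C0: "0 < C" using T(2) by (simp add: zero_less_mult_iff)
  \<comment> \<open>Square integrability comes from \<open>B5\<close>: a Bochner integral of a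
    non-integrable function is 0 by convention, whereas \<open>V T\<close> is positive for
    arbitrarily large T.\<close>
  have int: "set_integrable lborel {0..t} (\<lambda>s. (\<phi> s)\<^sup>2)" for t
  proof -
    have "\<forall>\<^sub>F T in at_top. t \<le> T \<and> 0 < V T"
      using C eventually_ge_at_top[of t] by eventually_elim auto
    from eventually_happens'[OF trivial_limit_at_top_linorder this]
    obtain T where T: "t \<le> T" "0 < V T" by blast
    then have "set_integrable lborel {0..T} (\<lambda>s. (\<phi> s)\<^sup>2)"
      unfolding V_def set_lebesgue_integral_def set_integrable_def
      by (metis not_integrable_integral_eq less_irrefl)
    then show ?thesis by (rule set_integrable_subset) (use T in auto)
  qed
  note V = square_integral_function[OF int, folded V_def]
  have V_mono: "V s \<le> V t" if "0 \<le> s" "s \<le> t" for s t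
    using V(2) that by (auto simp: mono_on_def)
  have V_nonneg: "0 \<le> V t" for t
    unfolding V_def set_lebesgue_integral_def by (intro integral_nonneg_AE) auto
  have \<phi>: "set_borel_measurable borel {0..t} \<phi>" for t
    using borel_measurable_integrable[OF B1_int[rule_format, of t, unfolded set_integrable_def]]
    by (simp add: set_borel_measurable_def)
  have bound: "(\<integral>\<^sup>+\<omega>. ennreal ((I t \<omega> - J \<omega>)\<^sup>2) \<partial>M) \<le> ennreal (16 * H * (t - s) powr (2 * H - 1) * (V t - V s))"
    if "0 \<le> s" "s \<le> t" "0 < t" "wiener_integral_fbm M H B \<phi> s J" for s t J
  proof -
    have "(\<integral>\<^sup>+\<omega>. ennreal ((I t \<omega> - J \<omega>)\<^sup>2) \<partial>M)
      \<le> ennreal (16 * H * (t - s) powr (2 * H - 1)) * (\<integral>\<^sup>+x. ennreal ((indicator {s<..t} x * \<phi> x)\<^sup>2) \<partial>lborel)"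
      using that I by (intro wiener_integral_fbm_increment_le[OF fbm H _ _ _ _ \<phi>]) auto
    also have "\<dots> = ennreal (16 * H * (t - s) powr (2 * H - 1) * (V t - V s))"
      unfolding V(3)[OF that(1,2)] using H V_mono[OF that(1,2)] by (intro ennreal_mult[symmetric]) auto
    finally show ?thesis .
  qed
  have "AE \<omega> in M. ((\<lambda>T. I T \<omega> / V T) \<longlongrightarrow> 0) at_top"
  proof (rule AE_ratio_tendsto_zero[where \<alpha> = "2 * H - 1" and p = p and c = "1 / C" and D = "16 * H"])
    show "\<forall>\<^sub>F t in at_top. 1 / C * t powr (2 * H - 1 + p) \<le> V t"
      using C by eventually_elim (use C0 in \<open>auto simp: field_simps\<close>)
    show "I t \<in> borel_measurable M" if "0 < t" for t
      using I that by (auto simp: wiener_integral_fbm_def)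
    show "(\<integral>\<^sup>+\<omega>. ennreal ((I t \<omega> - I s \<omega>)\<^sup>2) \<partial>M) \<le> ennreal (16 * H * (t - s) powr (2 * H - 1) * (V t - V s))"
      if "0 < s" "s \<le> t" for s t
      using that I by (intro bound) auto
    show "(\<integral>\<^sup>+\<omega>. ennreal ((I t \<omega>)\<^sup>2) \<partial>M) \<le> ennreal (16 * H * t powr (2 * H - 1) * V t)" if "0 < t" for t
    proof -
      have "(\<integral>\<^sup>+\<omega>. ennreal ((I t \<omega>)\<^sup>2) \<partial>M) \<le> ennreal (16 * H * t powr (2 * H - 1) * (V t - V 0))"
        using bound[OF _ _ that wiener_integral_fbm_zero[OF fbm]] that by simp
      also have "\<dots> \<le> ennreal (16 * H * t powr (2 * H - 1) * V t)"
        using H V_nonneg[of 0] by (intro ennreal_leI mult_left_mono) auto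
      finally show ?thesis .
    qed
    show "mono_on {0<..} V" using V(2) by (rule mono_on_subset) auto
  qed (use H p C0 V(1) cont in auto)
  then show "AE \<omega> in M. ((\<lambda>T. \<theta> + I T \<omega> / (LINT s:{0..T}|lborel. (\<phi> s)\<^sup>2)) \<longlongrightarrow> \<theta>) at_top"
  proof eventually_elim
    case (elim \<omega>)
    from tendsto_add[OF tendsto_const[of \<theta>] elim] show ?case by (simp add: V_def)
  qed
qed

end
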